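(* Let $\Omega\subseteq\mathbb{R}^d$ be the sample space and $E\subseteq\Omega$ an event. For a Borel probability measure $\widehat{\mathbb{P}}$ on $\Omega$ and $\varepsilon>0$ define $$\sigma^2(E;\widehat{\mathbb{P}},\varepsilon)=\mathbb{E}_{x\sim\widehat{\mathbb{P}}}\left[\operatorname{Var}_{z\sim\mathbb{Q}_{x,\varepsilon}}[\mathbf{1}_E(z)]\right].$$ For any $b_0>0$, the following holds, in the regime $\overline\rho/\varepsilon\to0$, for all $\varepsilon>0$ and all Borel probability measures $\widehat{\mathbb{P}}$ satisfying $\inf_{\varepsilon'>0}\sigma^2(E;\widehat{\mathbb{P}},\varepsilon')\ge b_0$: $$\sup_{\mathbb{P}:\ \mathcal{W}_\varepsilon(\widehat{\mathbb{P}},\mathbb{P})\le\rho}\mathbb{P}(E)-\left(\mathbb{E}_{x\sim\widehat{\mathbb{P}}}[\mathbb{Q}_{x,\varepsilon}(E)]+(2\overline\rho/\varepsilon)^{1/2}\,\sigma(E;\widehat{\mathbb{P}},\varepsilon)\right)=o\left((\overline\rho/\varepsilon)^{1/2}\right).$$ That is, for every $\eta>0$ there is $\delta_0>0$ (depending on $b_0$ and $\eta$) such that the absolute value of the left-hand side is at most $\eta(\overline\rho/\varepsilon)^{1/2}$ for all such $\varepsilon,\widehat{\mathbb{P}}$ and all $\rho$ with $0<\overline\rho/\varepsilon<\delta_0$.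
   Context: $c(x,z)$ is a transport cost function on $\Omega\times\Omega$ with $\int_\Omega e^{-c(x,z)/\varepsilon}\,\mathrm{d}z<\infty$ for $\widehat{\mathbb{P}}$-almost every $x$. The Sinkhorn discrepancy of probability distributions $\mathbb{P},\mathbb{Q}$ on $\Omega$ is $$\mathcal{W}_\varepsilon(\mathbb{P},\mathbb{Q})=\inf_{\gamma\in\Gamma(\mathbb{P},\mathbb{Q})}\left\{\mathbb{E}_{(x,y)\sim\gamma}[c(x,y)]+\varepsilon H(\gamma)\right\},\qquad H(\gamma)=\mathbb{E}_{(x,y)\sim\gamma}\left[\log\left(\frac{\mathrm{d}\gamma(x,y)}{\mathrm{d}\gamma(x)\,\mathrm{d}y}\right)\right],$$ where $\Gamma(\mathbb{P},\mathbb{Q})$ is the set of joint distributions with first marginal $\mathbb{P}$ and second marginal $\mathbb{Q}$, $\mathrm{d}\gamma(x)$ denotes the first marginal of $\gamma$ and $\mathrm{d}y$ Lebesgue measure (so $H(\gamma)$ is the entropy of $\gamma$ relative to first marginal $\otimes$ Lebesgue). The supremum is over probability distributions $\mathbb{P}$ on $\Omega$. $\mathbb{Q}_{x,\varepsilon}$ is the probability distribution on $\Omega$ with density $\frac{\mathrm{d}\mathbb{Q}_{x,\varepsilon}(z)}{\mathrm{d}z}\propto e^{-c(x,z)/\varepsilon}$. The modified radius is $$\overline\rho=\rho+\mathbb{E}_{x\sim\widehat{\mathbb{P}}}\left[\varepsilon\log\int_\Omega e^{-c(x,z)/\varepsilon}\,\mathrm{d}z\right].$$ $\mathbf{1}_E$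 is the indicator function of $E$ and $\sigma=\sqrt{\sigma^2}$. *)

theory Defs
  imports "HOL-Probability.Probability"
begin

abbreviation borel_of :: "(real ^ 'd) set \<Rightarrow> (real ^ 'd) measure" where
  "borel_of \<Omega> \<equiv> restrict_space borel \<Omega>"

abbreviation lebesgue_of :: "(real ^ 'd) set \<Rightarrow> (real ^ 'd) measure" where
  "lebesgue_of \<Omega> \<equiv> restrict_space lborel \<Omega>"

definition prob_measure_on :: "(real ^ 'd) set \<Rightarrow> (real ^ 'd) measure \<Rightarrow> bool" where
  "prob_measure_on \<Omega> P \<longleftrightarrow> prob_space P \<and> sets P = sets (borel_of \<Omega>)"

definition partition_fn ::
  "(real ^ 'd) set \<Rightarrow> (real ^ 'd \<Rightarrow> real ^ 'd \<Rightarrow> real) \<Rightarrow> real \<Rightarrow> real ^ 'd \<Rightarrow> real" where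
  "partition_fn \<Omega> c \<epsilon> x = (\<integral>z. exp (- c x z / \<epsilon>) \<partial>lebesgue_of \<Omega>)"

definition gibbs ::
  "(real ^ 'd) set \<Rightarrow> (real ^ 'd \<Rightarrow> real ^ 'd \<Rightarrow> real) \<Rightarrow> real \<Rightarrow> real ^ 'd \<Rightarrow> (real ^ 'd) measure" where
  "gibbs \<Omega> c \<epsilon> x =
     density (lebesgue_of \<Omega>) (\<lambda>z. ennreal (exp (- c x z / \<epsilon>) / partition_fn \<Omega> c \<epsilon> x))"

definition sigma_sq ::
  "(real ^ 'd) set \<Rightarrow> (real ^ 'd \<Rightarrow> real ^ 'd \<Rightarrow> real) \<Rightarrow> (real ^ 'd) set \<Rightarrow> (real ^ 'd) measure
    \<Rightarrow> real \<Rightarrow> real" where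
  "sigma_sq \<Omega> c E Phat \<epsilon> = (\<integral>x. prob_space.variance (gibbs \<Omega> c \<epsilon> x) (indicator E) \<partial>Phat)"

definition modified_radius ::
  "(real ^ 'd) set \<Rightarrow> (real ^ 'd \<Rightarrow> real ^ 'd \<Rightarrow> real) \<Rightarrow> (real ^ 'd) measure \<Rightarrow> real \<Rightarrow> real
    \<Rightarrow> real" where
  "modified_radius \<Omega> c Phat \<epsilon> \<rho> = \<rho> + (\<integral>x. \<epsilon> * ln (partition_fn \<Omega> c \<epsilon> x) \<partial>Phat)"

text \<open>Expectation with values in the extended reals. It is the usual one as soon as the positive or
  the negative part of \<open>f\<close> has finite integral; if both are infinite, its value is \<open>\<infinity>\<close>.\<close>

definition ext_expectation :: "'a measure \<Rightarrow> ('a \<Rightarrow> real) \<Rightarrow> ereal" where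
  "ext_expectation M f =
     enn2ereal (\<integral>\<^sup>+x. ennreal (f x) \<partial>M) - enn2ereal (\<integral>\<^sup>+x. ennreal (- f x) \<partial>M)"

definition couplings ::
  "(real ^ 'd) set \<Rightarrow> (real ^ 'd) measure \<Rightarrow> (real ^ 'd) measure
    \<Rightarrow> ((real ^ 'd) \<times> (real ^ 'd)) measure set" where
  "couplings \<Omega> P Q =
     {\<gamma>. prob_space \<gamma> \<and> sets \<gamma> = sets (borel_of \<Omega> \<Otimes>\<^sub>M borel_of \<Omega>) \<and>
         distr \<gamma> (borel_of \<Omega>) fst = P \<and> distr \<gamma> (borel_of \<Omega>) snd = Q}"

definition reference ::
  "(real ^ 'd) set \<Rightarrow> ((real ^ 'd) \<times> (real ^ 'd)) measure \<Rightarrow> ((real ^ 'd) \<times> (real ^ 'd)) measure" where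
  "reference \<Omega> \<gamma> = distr \<gamma> (borel_of \<Omega>) fst \<Otimes>\<^sub>M lebesgue_of \<Omega>"

text \<open>Argument order: \<open>entropy_density b M N\<close> is the logarithm to base \<open>b\<close> of the density of \<open>N\<close> with
  respect to \<open>M\<close>.\<close>

abbreviation log_density ::
  "(real ^ 'd) set \<Rightarrow> ((real ^ 'd) \<times> (real ^ 'd)) measure \<Rightarrow> (real ^ 'd) \<times> (real ^ 'd) \<Rightarrow> real" where
  "log_density \<Omega> \<gamma> \<equiv> entropy_density (exp 1) (reference \<Omega> \<gamma>) \<gamma>"

definition rel_entropy ::
  "(real ^ 'd) set \<Rightarrow> ((real ^ 'd) \<times> (real ^ 'd)) measure \<Rightarrow> ereal" where
  "rel_entropy \<Omega> \<gamma> =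
     (if absolutely_continuous (reference \<Omega> \<gamma>) \<gamma>
      then ext_expectation \<gamma> (log_density \<Omega> \<gamma>) else \<infinity>)"

text \<open>The sum of the expectations of \<open>f\<close> and \<open>g\<close> makes sense: both exist in the extended reals, and
  they are not infinite with opposite signs.\<close>

definition sum_determinate :: "'a measure \<Rightarrow> ('a \<Rightarrow> real) \<Rightarrow> ('a \<Rightarrow> real) \<Rightarrow> bool" where
  "sum_determinate M f g \<longleftrightarrow>
     (\<integral>\<^sup>+x. ennreal (f x) \<partial>M) < \<infinity> \<and> (\<integral>\<^sup>+x. ennreal (g x) \<partial>M) < \<infinity> \<or>
     (\<integral>\<^sup>+x. ennreal (- f x) \<partial>M) < \<infinity> \<and> (\<integral>\<^sup>+x. ennreal (- g x) \<partial>M) < \<infinity>"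

text \<open>The cost \<open>c\<close> may have either sign and entropy relative to Lebesgue measure may be \<open>-\<infinity>\<close>, so the
  expected cost plus \<open>\<epsilon>\<close> times the entropy can be of the form \<open>\<infinity> - \<infinity>\<close>. A coupling without a
  density gets the value \<open>\<infinity>\<close>. For a coupling with a density, the two expectations are taken jointly
  if their sum is indeterminate. This is consistent: the joint expectation equals the sum whenever
  the sum makes sense, by the lemma \<open>sinkhorn_objective_joint\<close> below.\<close>

definition sinkhorn_objective ::
  "(real ^ 'd) set \<Rightarrow> (real ^ 'd \<Rightarrow> real ^ 'd \<Rightarrow> real) \<Rightarrow> real
    \<Rightarrow> ((real ^ 'd) \<times> (real ^ 'd)) measure \<Rightarrow> ereal" where
  "sinkhorn_objective \<Omega> c \<epsilon> \<gamma> =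
     (if \<not> absolutely_continuous (reference \<Omega> \<gamma>) \<gamma> then \<infinity>
      else if sum_determinate \<gamma> (\<lambda>(x, y). c x y) (log_density \<Omega> \<gamma>)
      then ext_expectation \<gamma> (\<lambda>(x, y). c x y) + ereal \<epsilon> * rel_entropy \<Omega> \<gamma>
      else ext_expectation \<gamma> (\<lambda>(x, y). c x y + \<epsilon> * log_density \<Omega> \<gamma> (x, y)))"

definition sinkhorn ::
  "(real ^ 'd) set \<Rightarrow> (real ^ 'd \<Rightarrow> real ^ 'd \<Rightarrow> real) \<Rightarrow> real
    \<Rightarrow> (real ^ 'd) measure \<Rightarrow> (real ^ 'd) measure \<Rightarrow> ereal" where
  "sinkhorn \<Omega> c \<epsilon> P Q = (INF \<gamma> \<in> couplings \<Omega> P Q. sinkhorn_objective \<Omega> c \<epsilon> \<gamma>)"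

lemma ext_expectation_eq:
  assumes f: "f \<in> borel_measurable M"
    and p: "p \<in> borel_measurable M" and q: "q \<in> borel_measurable M"
    and nn: "\<And>x. 0 \<le> p x" "\<And>x. 0 \<le> q x" and d: "\<And>x. f x = p x - q x"
    and fin: "(\<integral>\<^sup>+x. ennreal (p x) \<partial>M) < \<infinity> \<or> (\<integral>\<^sup>+x. ennreal (q x) \<partial>M) < \<infinity>"
  shows "ext_expectation M f =
    enn2ereal (\<integral>\<^sup>+x. ennreal (p x) \<partial>M) - enn2ereal (\<integral>\<^sup>+x. ennreal (q x) \<partial>M)"
proof -
  let ?I = "\<lambda>g. enn2ereal (\<integral>\<^sup>+x. ennreal (g x) \<partial>M)"
  have le: "?I f \<le> ?I p" "?I (\<lambda>x. - f x) \<le> ?I q"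
    using nn d by (auto intro!: nn_integral_mono ennreal_leI simp: less_eq_ennreal.rep_eq[symmetric])
  have fin': "?I p < \<infinity> \<or> ?I q < \<infinity>"
    using fin by (simp add: less_ennreal.rep_eq)
  have "(\<integral>\<^sup>+x. ennreal (f x) + ennreal (q x) \<partial>M) = (\<integral>\<^sup>+x. ennreal (- f x) + ennreal (p x) \<partial>M)"
  proof (rule nn_integral_cong)
    fix x show "ennreal (f x) + ennreal (q x) = ennreal (- f x) + ennreal (p x)"
      using nn[of x] d[of x]
      by (cases "0 \<le> f x") (auto simp: ennreal_neg ennreal_plus[symmetric] simp del: ennreal_plus)
  qed
  then have "(\<integral>\<^sup>+x. ennreal (f x) \<partial>M) + (\<integral>\<^sup>+x. ennreal (q x) \<partial>M) =
      (\<integral>\<^sup>+x. ennreal (- f x) \<partial>M) + (\<integral>\<^sup>+x. ennreal (p x) \<partial>M)"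
    using f p q by (simp add: nn_integral_add)
  then have "?I f + ?I q = ?I (\<lambda>x. - f x) + ?I p"
    by (metis plus_ennreal.rep_eq)
  moreover have "0 \<le> ?I f" "0 \<le> ?I q" "0 \<le> ?I p" "0 \<le> ?I (\<lambda>x. - f x)"
    by simp_all
  ultimately show ?thesis
    using le fin' unfolding ext_expectation_def
    by (cases "?I f"; cases "?I q"; cases "?I p"; cases "?I (\<lambda>x. - f x)") auto
qed

lemma ext_expectation_add:
  assumes f: "f \<in> borel_measurable M" and g: "g \<in> borel_measurable M" and "0 < e"
    and det: "sum_determinate M f g"
  shows "ext_expectation M f + ereal e * ext_expectation M g =
    ext_expectation M (\<lambda>x. f x + e * g x)"
proof -
  let ?I = "\<lambda>g. enn2ereal (\<integral>\<^sup>+x. ennreal (g x) \<partial>M)"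
  have add: "(\<integral>\<^sup>+x. ennreal (max 0 (u x) + e * max 0 (v x)) \<partial>M) =
      (\<integral>\<^sup>+x. ennreal (u x) \<partial>M) + ennreal e * (\<integral>\<^sup>+x. ennreal (v x) \<partial>M)"
    if [measurable]: "u \<in> borel_measurable M" "v \<in> borel_measurable M" for u v
  proof -
    have "(\<integral>\<^sup>+x. ennreal (max 0 (u x) + e * max 0 (v x)) \<partial>M) =
        (\<integral>\<^sup>+x. ennreal (u x) + ennreal e * ennreal (v x) \<partial>M)"
      using \<open>0 < e\<close> by (intro nn_integral_cong) (auto simp: ennreal_mult max_def ennreal_neg ennreal_plus)
    then show ?thesis
      by (simp add: nn_integral_add nn_integral_cmult)
  qed
  have fg: "(\<integral>\<^sup>+x. ennreal (max 0 (f x) + e * max 0 (g x)) \<partial>M) =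
      (\<integral>\<^sup>+x. ennreal (f x) \<partial>M) + ennreal e * (\<integral>\<^sup>+x. ennreal (g x) \<partial>M)"
    "(\<integral>\<^sup>+x. ennreal (max 0 (- f x) + e * max 0 (- g x)) \<partial>M) =
      (\<integral>\<^sup>+x. ennreal (- f x) \<partial>M) + ennreal e * (\<integral>\<^sup>+x. ennreal (- g x) \<partial>M)"
    using f g by (auto intro!: add)
  have "ext_expectation M (\<lambda>x. f x + e * g x) =
      enn2ereal (\<integral>\<^sup>+x. ennreal (max 0 (f x) + e * max 0 (g x)) \<partial>M) -
      enn2ereal (\<integral>\<^sup>+x. ennreal (max 0 (- f x) + e * max 0 (- g x)) \<partial>M)"
  proof (rule ext_expectation_eq)
    show "f x + e * g x = max 0 (f x) + e * max 0 (g x) - (max 0 (- f x) + e * max 0 (- g x))" for x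
      by (auto simp: max_def algebra_simps)
    show "(\<integral>\<^sup>+x. ennreal (max 0 (f x) + e * max 0 (g x)) \<partial>M) < \<infinity> \<or>
        (\<integral>\<^sup>+x. ennreal (max 0 (- f x) + e * max 0 (- g x)) \<partial>M) < \<infinity>"
      using det unfolding fg sum_determinate_def by (auto simp: ennreal_mult_less_top)
  qed (use f g \<open>0 < e\<close> in auto)
  also have "\<dots> = (?I f + ereal e * ?I g) - (?I (\<lambda>x. - f x) + ereal e * ?I (\<lambda>x. - g x))"
    using \<open>0 < e\<close> unfolding fg by (simp add: plus_ennreal.rep_eq times_ennreal.rep_eq)
  also have "\<dots> = ext_expectation M f + ereal e * ext_expectation M g"
  proof -
    have "?I f < \<infinity> \<and> ?I g < \<infinity> \<or> ?I (\<lambda>x. - f x) < \<infinity> \<and> ?I (\<lambda>x. - g x) < \<infinity>"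
      using det by (simp add: sum_determinate_def less_ennreal.rep_eq)
    moreover have "0 \<le> ?I f" "0 \<le> ?I g" "0 \<le> ?I (\<lambda>x. - f x)" "0 \<le> ?I (\<lambda>x. - g x)"
      by simp_all
    ultimately show ?thesis
      using \<open>0 < e\<close> unfolding ext_expectation_def
      by (cases "?I f"; cases "?I g"; cases "?I (\<lambda>x. - f x)"; cases "?I (\<lambda>x. - g x)")
        (auto simp: algebra_simps)
  qed
  finally show ?thesis by simp
qed

lemma sinkhorn_objective_joint:
  assumes c: "(\<lambda>(x, y). c x y) \<in> borel_measurable (borel_of \<Omega> \<Otimes>\<^sub>M borel_of \<Omega>)"
    and \<gamma>: "sets \<gamma> = sets (borel_of \<Omega> \<Otimes>\<^sub>M borel_of \<Omega>)" and "0 < \<epsilon>"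
  shows "sinkhorn_objective \<Omega> c \<epsilon> \<gamma> =
     (if absolutely_continuous (reference \<Omega> \<gamma>) \<gamma>
      then ext_expectation \<gamma> (\<lambda>(x, y). c x y + \<epsilon> * log_density \<Omega> \<gamma> (x, y)) else \<infinity>)"
proof -
  have s: "sets (reference \<Omega> \<gamma>) = sets \<gamma>"
    unfolding reference_def \<gamma> by (intro sets_pair_measure_cong) (auto simp: sets_restrict_space)
  have "(\<lambda>(x, y). c x y) \<in> borel_measurable \<gamma>"
    using c measurable_cong_sets[OF \<gamma> refl] by blast
  moreover have "log_density \<Omega> \<gamma> \<in> borel_measurable \<gamma>"
    unfolding entropy_density_def measurable_cong_sets[OF s[symmetric] refl] by measurable
  ultimately show ?thesis
    using ext_expectation_add[of "\<lambda>(x, y). c x y" \<gamma> "log_density \<Omega> \<gamma>" \<epsilon>] \<open>0 < \<epsilon>\<close>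
    by (auto simp: sinkhorn_objective_def rel_entropy_def case_prod_unfold)
qed

end

theory Submission
  imports Defs
begin

text \<open>Let \<open>\<pi>\<close> be the Gibbs coupling, whose first marginal is \<open>Phat\<close> and whose conditional laws are
  the \<open>gibbs \<Omega> c \<epsilon> x\<close>. For a coupling \<open>\<gamma>\<close> with the same first marginal, the Sinkhorn objective
  equals \<open>\<epsilon>\<close> times the Kullback-Leibler divergence of \<open>\<gamma>\<close> from \<open>\<pi>\<close>, minus the expectation of
  \<open>\<epsilon> * ln (partition_fn \<Omega> c \<epsilon> x)\<close>, so the constraint says that this divergence is at most
  \<open>r = modified_radius \<Omega> c Phat \<epsilon> \<rho> / \<epsilon>\<close>. Write \<open>p x\<close> for the mass that \<open>gibbs \<Omega> c \<epsilon> x\<close> gives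
  to \<open>E\<close>, \<open>g = indicator E z - p x\<close> and \<open>V = sigma_sq \<Omega> c E Phat \<epsilon>\<close>, the second moment of \<open>g\<close>
  under \<open>\<pi>\<close>. The Gibbs variational principle with test function \<open>l * g\<close> bounds the gain
  \<open>measure P E - (\<integral>x. p x \<partial>Phat)\<close> by \<open>r / l + l * V / 2 + l\<^sup>2 * V\<close>, and the coupling with density
  \<open>1 + l * g\<close> relative to \<open>\<pi>\<close> attains the gain \<open>l * V\<close> at divergence at most
  \<open>l\<^sup>2 * V / 2 + l ^ 3 * V\<close>. With \<open>l\<close> close to \<open>sqrt (2 * r / V)\<close>, both give
  \<open>sqrt (2 * r * V)\<close> up to an error of \<open>2 * r\<close>.\<close>

section \<open>Third-order scalar inequalities\<close>

text \<open>Taylor expansion with Lagrange remainder: for \<open>\<bar>u\<bar> \<le> 1\<close> the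
  cubic coefficient \<open>exp t / 6\<close> is at most \<open>3 / 6\<close>, rounded up to 1. The
  remainder carries \<open>\<bar>u\<bar>\<close> because \<open>u\<close> takes both signs.\<close>

lemma exp_le_quadratic_plus_cubic:
  fixes u :: real
  assumes "\<bar>u\<bar> \<le> 1"
  shows "exp u \<le> 1 + u + u\<^sup>2 / 2 + \<bar>u\<bar> * u\<^sup>2"
proof -
  obtain t where t: "\<bar>t\<bar> \<le> \<bar>u\<bar>" and "exp u = (\<Sum>m<3. u ^ m / fact m) + exp t / fact 3 * u ^ 3"
    using Maclaurin_exp_le[of u 3] by blast
  then have eq: "exp u = 1 + u + u\<^sup>2 / 2 + exp t / 6 * u ^ 3"
    by (simp add: eval_nat_numeral)
  have "exp t \<le> exp 1"
    using t assms by simp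
  also have "\<dots> \<le> (3::real)"
    by (rule exp_le)
  finally have "exp t / 6 \<le> 1"
    by simp
  have "exp t / 6 * u ^ 3 \<le> \<bar>exp t / 6 * u ^ 3\<bar>"
    by (rule abs_ge_self)
  also have "\<dots> = exp t / 6 * (\<bar>u\<bar> * u\<^sup>2)"
    by (simp add: abs_mult power3_eq_cube power2_eq_square)
  also have "\<dots> \<le> 1 * (\<bar>u\<bar> * u\<^sup>2)"
    by (intro mult_right_mono) (use \<open>exp t / 6 \<le> 1\<close> in auto)
  finally show ?thesis
    by (simp add: eq)
qed

text \<open>The difference of the two sides has derivative \<open>v ^ 3 / (1 + v)\<close>, which has
  the sign of \<open>v\<close>, so its minimum is its value 0 at the origin.\<close>

lemma ln_one_plus_le_cubic:
  fixes u :: real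
  assumes "-1 < u"
  shows "ln (1 + u) \<le> u - u\<^sup>2 / 2 + u ^ 3 / 3"
proof -
  define f where "f v = v - v\<^sup>2 / 2 + v ^ 3 / 3 - ln (1 + v)" for v :: real
  have deriv: "(f has_real_derivative (v ^ 3 / (1 + v))) (at v)" if "-1 < v" for v
  proof -
    have "(f has_real_derivative (1 - v + v\<^sup>2 - 1 / (1 + v))) (at v)"
      unfolding f_def using that by (auto intro!: derivative_eq_intros simp: power2_eq_square)
    also have "1 - v + v\<^sup>2 - 1 / (1 + v) = v ^ 3 / (1 + v)"
      using that by (simp add: field_simps power2_eq_square power3_eq_cube)
    finally show ?thesis .
  qed
  have "f 0 \<le> f u"
  proof (cases "0 \<le> u")
    case True
    have "\<exists>y. DERIV f x :> y \<and> 0 \<le> y" if "0 \<le> x" "x \<le> u" for x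
      using that deriv[of x] by (intro exI[of _ "x ^ 3 / (1 + x)"]) auto
    then show ?thesis
      by (rule DERIV_nonneg_imp_nondecreasing[OF True])
  next
    case False
    have "\<exists>y. DERIV f x :> y \<and> y \<le> 0" if "u \<le> x" "x \<le> 0" for x
    proof (intro exI conjI)
      show "DERIV f x :> x ^ 3 / (1 + x)"
        using deriv[of x] that assms by simp
      have "x ^ 3 \<le> 0"
        using that by (simp add: power_le_zero_eq)
      then show "x ^ 3 / (1 + x) \<le> 0"
        using that assms by (simp add: divide_nonpos_pos)
    qed
    then show ?thesis
      using False by (intro DERIV_nonpos_imp_nonincreasing[of u 0 f]) simp_all
  qed
  then show ?thesis
    by (simp add: f_def)
qed

text \<open>Multiplying the logarithm bound by \<open>1 + u\<close> turns
  \<open>- u\<^sup>2 / 2\<close> into \<open>+ u\<^sup>2 / 2\<close>. The right-hand side is that of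
  the exponential bound without the 1, so one averaging lemma serves both.\<close>

lemma entropy_le_quadratic_plus_cubic:
  fixes u :: real
  assumes "\<bar>u\<bar> \<le> 1 / 2"
  shows "(1 + u) * ln (1 + u) \<le> u + u\<^sup>2 / 2 + \<bar>u\<bar> * u\<^sup>2"
proof -
  have "(1 + u) * ln (1 + u) \<le> (1 + u) * (u - u\<^sup>2 / 2 + u ^ 3 / 3)"
    using assms by (intro mult_left_mono ln_one_plus_le_cubic) auto
  also have "\<dots> = u + u\<^sup>2 / 2 + (u / 3 - 1 / 6) * u * u\<^sup>2"
    by (simp add: field_simps power2_eq_square power3_eq_cube)
  also have "\<dots> \<le> u + u\<^sup>2 / 2 + \<bar>u\<bar> * u\<^sup>2"
  proof -
    have "(u / 3 - 1 / 6) * u \<le> \<bar>u / 3 - 1 / 6\<bar> * \<bar>u\<bar>"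
      by (metis abs_ge_self abs_mult)
    also have "\<dots> \<le> 1 * \<bar>u\<bar>"
      by (intro mult_right_mono) (use assms in auto)
    finally show ?thesis
      by (simp add: mult_right_mono)
  qed
  finally show ?thesis .
qed

text \<open>The arguments of \<open>f\<close> are the values of
  \<open>l * (indicator E z - p)\<close> on and off an event of probability \<open>p\<close>. The
  linear term averages to 0, the quadratic one to the variance, and the cubic one is at most
  \<open>l\<close> times the square. It is used with \<open>f = exp\<close>, \<open>a = 1\<close>
  for the upper bound on the gain, and with the entropy function, \<open>a = 0\<close>, for
  attainment.\<close>

lemma centred_bernoulli_mean_le:
  fixes f :: "real \<Rightarrow> real" and p l :: real
  assumes f: "\<And>u. \<bar>u\<bar> \<le> l \<Longrightarrow> f u \<le> a + u + u\<^sup>2 / 2 + \<bar>u\<bar> * u\<^sup>2"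
    and p: "0 \<le> p" "p \<le> 1" and l: "0 \<le> l"
  shows "p * f (l * (1 - p)) + (1 - p) * f (l * (0 - p)) \<le> a + (l\<^sup>2 / 2 + l ^ 3) * (p * (1 - p))"
proof -
  have le: "f u \<le> a + u + (1 / 2 + l) * u\<^sup>2" if "\<bar>u\<bar> \<le> l" for u
  proof -
    have "\<bar>u\<bar> * u\<^sup>2 \<le> l * u\<^sup>2"
      using that by (intro mult_right_mono) auto
    with f[OF that] show ?thesis
      by (simp add: algebra_simps)
  qed
  have "\<bar>l * (1 - p)\<bar> \<le> l" "\<bar>l * (0 - p)\<bar> \<le> l"
    using p l by (auto simp: abs_mult intro: mult_left_le)
  then have "p * f (l * (1 - p)) + (1 - p) * f (l * (0 - p)) \<le>
      p * (a + l * (1 - p) + (1 / 2 + l) * (l * (1 - p))\<^sup>2) +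
      (1 - p) * (a + l * (0 - p) + (1 / 2 + l) * (l * (0 - p))\<^sup>2)"
    using p by (intro add_mono mult_left_mono le) auto
  also have "\<dots> = a + (l\<^sup>2 / 2 + l ^ 3) * (p * (1 - p))"
    by (simp add: field_simps power2_eq_square power3_eq_cube)
  finally show ?thesis .
qed

section \<open>Restricted Lebesgue measure and extended expectations\<close>

lemma sigma_finite_lebesgue_of:
  assumes "\<Omega> \<in> sets borel"
  shows "sigma_finite_measure (lebesgue_of \<Omega>)"
  using assms by (intro sigma_finite_measure_restrict_space sigma_finite_lborel) auto

lemma sets_lebesgue_of: "sets (lebesgue_of \<Omega>) = sets (borel_of \<Omega>)"
  by (simp add: sets_restrict_space)

lemma space_borel_of [simp]: "space (borel_of \<Omega>) = \<Omega>"
  by (simp add: space_restrict_space)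

lemma ext_expectation_integrable:
  assumes "integrable M f"
  shows "ext_expectation M f = ereal (\<integral>x. f x \<partial>M)"
proof -
  obtain r q where r: "0 \<le> r" "(\<integral>\<^sup>+x. ennreal (f x) \<partial>M) = ennreal r"
    and q: "0 \<le> q" "(\<integral>\<^sup>+x. ennreal (- f x) \<partial>M) = ennreal q" and "(\<integral>x. f x \<partial>M) = r - q"
    using assms by (rule integrableE) blast
  then show ?thesis
    by (simp add: ext_expectation_def enn2ereal_ennreal)
qed

text \<open>An integrable minorant makes the negative part of \<open>F\<close> integrable, so either
  \<open>F\<close> is integrable or its expectation is \<open>\<infinity>\<close>.\<close>

lemma ext_expectation_ge:
  assumes W: "integrable M W" and F: "F \<in> borel_measurable M" and le: "AE x in M. W x \<le> F x"
  shows "ereal (\<integral>x. W x \<partial>M) \<le> ext_expectation M F"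
proof (cases "(\<integral>\<^sup>+x. ennreal (F x) \<partial>M) = \<infinity>")
  case True
  then show ?thesis
    by (simp add: ext_expectation_def)
next
  case False
  have "(\<integral>\<^sup>+x. ennreal (- F x) \<partial>M) \<le> (\<integral>\<^sup>+x. ennreal (- W x) \<partial>M)"
    using le by (intro nn_integral_mono_AE) (auto elim!: eventually_mono intro: ennreal_leI)
  moreover have "(\<integral>\<^sup>+x. ennreal (- W x) \<partial>M) < \<infinity>"
    using W by (simp add: real_integrable_def top.not_eq_extremum)
  ultimately have "integrable M F"
    using False F by (auto simp: real_integrable_def)
  then show ?thesis
    using W le by (simp add: ext_expectation_integrable integral_mono_AE)
qed

section \<open>The Gibbs kernel and the Gibbs coupling\<close>

text \<open>A divergent Bochner integral has value 0, so \<open>Z_pos\<close> also encodes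
  integrability of \<open>exp (- c x z / \<epsilon>)\<close> in \<open>z\<close>.\<close>

locale gibbs_coupling =
  fixes \<Omega> E :: "(real ^ 'd) set" and c :: "real ^ 'd \<Rightarrow> real ^ 'd \<Rightarrow> real"
    and \<epsilon> :: real and Phat :: "(real ^ 'd) measure"
  assumes \<Omega>: "\<Omega> \<in> sets borel" and E: "E \<in> sets borel" and E_sub: "E \<subseteq> \<Omega>"
    and c_meas: "(\<lambda>(x, z). c x z) \<in> borel_measurable (borel_of \<Omega> \<Otimes>\<^sub>M borel_of \<Omega>)"
    and \<epsilon>_pos: "0 < \<epsilon>"
    and Phat: "prob_measure_on \<Omega> Phat"
    and Z_pos: "AE x in Phat. 0 < partition_fn \<Omega> c \<epsilon> x"
    and ln_Z: "integrable Phat (\<lambda>x. \<epsilon> * ln (partition_fn \<Omega> c \<epsilon> x))"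
begin

abbreviation Z where "Z \<equiv> partition_fn \<Omega> c \<epsilon>"

definition h where "h = (\<lambda>(x, z). exp (- c x z / \<epsilon>) / Z x)"

definition p where "p x = measure (gibbs \<Omega> c \<epsilon> x) E"

text \<open>The common value of \<open>reference\<close> at all couplings with first marginal
  \<open>Phat\<close>.\<close>

definition ref where "ref = Phat \<Otimes>\<^sub>M lebesgue_of \<Omega>"

definition gibbs_joint where "gibbs_joint = density ref h"

sublocale Phat: prob_space Phat
  using Phat by (simp add: prob_measure_on_def)

sublocale leb: sigma_finite_measure "lebesgue_of \<Omega>"
  by (rule sigma_finite_lebesgue_of[OF \<Omega>])

sublocale pair: pair_sigma_finite Phat "lebesgue_of \<Omega>" ..

sublocale ref: sigma_finite_measure ref
  unfolding ref_def by (rule pair.sigma_finite_measure_axioms)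

lemma sets_Phat [measurable_cong, simp]: "sets Phat = sets (borel_of \<Omega>)"
  using Phat by (simp add: prob_measure_on_def)

lemma space_Phat [simp]: "space Phat = \<Omega>"
  using sets_eq_imp_space_eq[OF sets_Phat] by simp

lemma measure_Phat [simp]: "measure Phat \<Omega> = 1"
  using Phat.prob_space by simp

lemma sets_ref [measurable_cong, simp]: "sets ref = sets (borel_of \<Omega> \<Otimes>\<^sub>M borel_of \<Omega>)"
  unfolding ref_def by (intro sets_pair_measure_cong sets_Phat sets_lebesgue_of)

lemma E_meas [measurable]: "E \<in> sets (borel_of \<Omega>)"
  using E E_sub by (simp add: sets_restrict_space_iff \<Omega>)

lemma c_measurable [measurable]: "case_prod c \<in> borel_measurable (borel_of \<Omega> \<Otimes>\<^sub>M borel_of \<Omega>)"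
  using c_meas .

lemma Z_measurable [measurable]: "Z \<in> borel_measurable (borel_of \<Omega>)"
proof -
  note sets_lebesgue_of[measurable_cong]
  show ?thesis
    unfolding partition_fn_def[abs_def] by measurable
qed

lemma h_measurable [measurable]: "h \<in> borel_measurable (borel_of \<Omega> \<Otimes>\<^sub>M borel_of \<Omega>)"
  unfolding h_def by measurable

lemma Z_nonneg: "0 \<le> Z x"
  by (simp add: partition_fn_def)

lemma h_nonneg [simp]: "0 \<le> h xz"
  by (simp add: h_def Z_nonneg split: prod.split)

lemma gibbs_eq: "gibbs \<Omega> c \<epsilon> x = density (lebesgue_of \<Omega>) (\<lambda>z. ennreal (h (x, z)))"
  by (simp add: gibbs_def h_def)

lemma sets_gibbs [simp, measurable_cong]: "sets (gibbs \<Omega> c \<epsilon> x) = sets (borel_of \<Omega>)"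
  by (simp add: gibbs_def sets_lebesgue_of)

lemma h_measurable_snd:
  assumes "x \<in> \<Omega>"
  shows "(\<lambda>z. h (x, z)) \<in> borel_measurable (lebesgue_of \<Omega>)"
  unfolding measurable_cong_sets[OF sets_lebesgue_of refl]
  using assms by (intro measurable_compose[OF measurable_Pair1' h_measurable]) simp

lemma prob_space_gibbs:
  assumes "x \<in> \<Omega>" "0 < Z x"
  shows "prob_space (gibbs \<Omega> c \<epsilon> x)"
proof (rule prob_spaceI)
  \<comment> \<open>Without integrability the partition function would be 0 by default.\<close>
  have int: "integrable (lebesgue_of \<Omega>) (\<lambda>z. exp (- c x z / \<epsilon>))"
    using assms(2) not_integrable_integral_eq unfolding partition_fn_def by fastforce
  have "emeasure (gibbs \<Omega> c \<epsilon> x) (space (gibbs \<Omega> c \<epsilon> x)) =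
      (\<integral>\<^sup>+z. ennreal (h (x, z)) \<partial>lebesgue_of \<Omega>)"
    using h_measurable_snd[OF assms(1)] unfolding gibbs_eq
    by (subst emeasure_density) (auto intro!: nn_integral_cong)
  also have "\<dots> = ennreal (\<integral>z. exp (- c x z / \<epsilon>) / Z x \<partial>lebesgue_of \<Omega>)"
    using int Z_nonneg[of x] by (subst nn_integral_eq_integral) (auto simp: h_def)
  also have "(\<integral>z. exp (- c x z / \<epsilon>) / Z x \<partial>lebesgue_of \<Omega>) = 1"
    using assms(2) by (simp add: partition_fn_def)
  finally show "emeasure (gibbs \<Omega> c \<epsilon> x) (space (gibbs \<Omega> c \<epsilon> x)) = 1"
    by simp
qed

text \<open>The tilts and their exponentials and logarithms depend on \<open>z\<close> only through
  membership in \<open>E\<close>. On such functions the kernel acts as a Bernoulli law with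
  parameter \<open>p x\<close>.\<close>

lemma integral_gibbs_two_valued:
  fixes a b :: real
  assumes "x \<in> \<Omega>" "0 < Z x"
  shows "(\<integral>z. (if z \<in> E then a else b) \<partial>gibbs \<Omega> c \<epsilon> x) = p x * a + (1 - p x) * b"
proof -
  interpret prob_space "gibbs \<Omega> c \<epsilon> x"
    by (rule prob_space_gibbs[OF assms])
  have "(\<integral>z. (if z \<in> E then a else b) \<partial>gibbs \<Omega> c \<epsilon> x) =
      (\<integral>z. b + (a - b) * indicator E z \<partial>gibbs \<Omega> c \<epsilon> x)"
    by (intro Bochner_Integration.integral_cong) auto
  also have "\<dots> = b + (a - b) * p x"
    by (subst Bochner_Integration.integral_add)
      (auto simp: p_def prob_space emeasure_eq_measure)
  finally show ?thesis
    by (simp add: algebra_simps)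
qed

lemma p_bounds:
  assumes "x \<in> \<Omega>"
  shows "0 \<le> p x" "p x \<le> 1"
proof -
  show "0 \<le> p x"
    by (simp add: p_def)
  show "p x \<le> 1"
  proof (cases "0 < Z x")
    case True
    then show ?thesis
      using prob_space.prob_le_1[OF prob_space_gibbs] assms by (simp add: p_def)
  next
    case False
    \<comment> \<open>Division by zero makes the density vanish here, so the bound holds at every
      point of \<open>\<Omega>\<close> and not just almost everywhere.\<close>
    then have "Z x = 0"
      using Z_nonneg[of x] by simp
    then show ?thesis
      by (simp add: p_def gibbs_def measure_def emeasure_density_const)
  qed
qed

lemma variance_gibbs:
  assumes "x \<in> \<Omega>" "0 < Z x"
  shows "prob_space.variance (gibbs \<Omega> c \<epsilon> x) (indicator E) = p x * (1 - p x)"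
proof -
  interpret prob_space "gibbs \<Omega> c \<epsilon> x"
    by (rule prob_space_gibbs[OF assms])
  have mean: "expectation (indicator E) = p x"
    by (simp add: p_def)
  have "variance (indicator E) =
      (\<integral>z. (if z \<in> E then (1 - p x)\<^sup>2 else (0 - p x)\<^sup>2) \<partial>gibbs \<Omega> c \<epsilon> x)"
    unfolding mean by (intro Bochner_Integration.integral_cong) auto
  also have "\<dots> = p x * (1 - p x)"
    unfolding integral_gibbs_two_valued[OF assms] by (simp add: power2_eq_square algebra_simps)
  finally show ?thesis .
qed

text \<open>On the right the measure no longer depends on \<open>x\<close>, as measurability in
  \<open>x\<close> and Fubini require.\<close>

lemma integral_gibbs:
  fixes f :: "real ^ 'd \<Rightarrow> real"
  assumes "x \<in> \<Omega>" and f: "f \<in> borel_measurable (borel_of \<Omega>)"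
  shows "(\<integral>z. f z \<partial>gibbs \<Omega> c \<epsilon> x) = (\<integral>z. h (x, z) * f z \<partial>lebesgue_of \<Omega>)"
proof -
  have "f \<in> borel_measurable (lebesgue_of \<Omega>)"
    using f by (simp add: measurable_cong_sets[OF sets_lebesgue_of refl])
  then show ?thesis
    unfolding gibbs_eq using h_measurable_snd[OF assms(1)] by (subst integral_density) auto
qed

lemma expectation_gibbs_indicator: "(\<integral>z. indicator E z \<partial>gibbs \<Omega> c \<epsilon> x) = p x"
  using sets.sets_into_space[OF E_meas] sets_eq_imp_space_eq[OF sets_gibbs, of x]
  by (simp add: p_def Int_absorb2)

lemma p_measurable [measurable]: "p \<in> borel_measurable (borel_of \<Omega>)"
proof -
  note sets_lebesgue_of[measurable_cong]
  have "(\<lambda>x. \<integral>z. h (x, z) * indicator E z \<partial>lebesgue_of \<Omega>) \<in> borel_measurable (borel_of \<Omega>)"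
    by measurable
  then show ?thesis
    by (rule measurable_cong[THEN iffD1, rotated])
      (subst expectation_gibbs_indicator[symmetric], subst integral_gibbs, auto)
qed

lemma AE_good: "AE x in Phat. x \<in> \<Omega> \<and> 0 < Z x"
  using Z_pos AE_space by eventually_elim simp

lemma sigma_sq_eq: "sigma_sq \<Omega> c E Phat \<epsilon> = (\<integral>x. p x * (1 - p x) \<partial>Phat)"
  unfolding sigma_sq_def
proof (rule Bochner_Integration.integral_cong_AE)
  note sets_lebesgue_of[measurable_cong]
  have "(\<lambda>x. \<integral>z. h (x, z) * (indicator E z - p x)\<^sup>2 \<partial>lebesgue_of \<Omega>) \<in> borel_measurable Phat"
    by measurable
  moreover have "(\<integral>z. h (x, z) * (indicator E z - p x)\<^sup>2 \<partial>lebesgue_of \<Omega>) =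
      prob_space.variance (gibbs \<Omega> c \<epsilon> x) (indicator E)" if "x \<in> space Phat" for x
    using that unfolding expectation_gibbs_indicator by (subst integral_gibbs) auto
  ultimately show "(\<lambda>x. prob_space.variance (gibbs \<Omega> c \<epsilon> x) (indicator E) :: real) \<in> borel_measurable Phat"
    by (rule measurable_cong[THEN iffD1, rotated])
  show "AE x in Phat. prob_space.variance (gibbs \<Omega> c \<epsilon> x) (indicator E) = p x * (1 - p x)"
    using AE_good by eventually_elim (use variance_gibbs in blast)
qed measurable

lemma nn_integral_h: "(\<integral>\<^sup>+xz. ennreal (h xz) \<partial>ref) = 1"
proof -
  have "(\<integral>\<^sup>+xz. ennreal (h xz) \<partial>ref) = (\<integral>\<^sup>+x. \<integral>\<^sup>+z. ennreal (h (x, z)) \<partial>lebesgue_of \<Omega> \<partial>Phat)"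
    unfolding ref_def
    by (subst leb.nn_integral_fst) (auto simp: measurable_cong_sets[OF sets_ref[unfolded ref_def] refl])
  also have "\<dots> = (\<integral>\<^sup>+x. 1 \<partial>Phat)"
  proof (rule nn_integral_cong_AE)
    show "AE x in Phat. (\<integral>\<^sup>+z. ennreal (h (x, z)) \<partial>lebesgue_of \<Omega>) = 1"
      using AE_good
    proof eventually_elim
      case (elim x)
      interpret prob_space "gibbs \<Omega> c \<epsilon> x"
        using elim by (auto intro: prob_space_gibbs)
      have "1 = emeasure (gibbs \<Omega> c \<epsilon> x) (space (gibbs \<Omega> c \<epsilon> x))"
        by (simp add: emeasure_space_1)
      also have "\<dots> = (\<integral>\<^sup>+z. ennreal (h (x, z)) \<partial>lebesgue_of \<Omega>)"
        using h_measurable_snd[of x] elim unfolding gibbs_eq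
        by (subst emeasure_density) (auto intro!: nn_integral_cong)
      finally show ?case ..
    qed
  qed
  finally show ?thesis
    using Phat.emeasure_space_1 by simp
qed

lemma sets_gibbs_joint [measurable_cong, simp]:
  "sets gibbs_joint = sets (borel_of \<Omega> \<Otimes>\<^sub>M borel_of \<Omega>)"
  by (simp add: gibbs_joint_def)

sublocale joint: prob_space gibbs_joint
proof (rule prob_spaceI)
  have "emeasure gibbs_joint (space gibbs_joint) = (\<integral>\<^sup>+xz. ennreal (h xz) \<partial>ref)"
    using sets.top[of ref] unfolding gibbs_joint_def
    by (subst emeasure_density) (auto intro!: nn_integral_cong)
  then show "emeasure gibbs_joint (space gibbs_joint) = 1"
    by (simp add: nn_integral_h)
qed

lemma space_gibbs_joint [simp]: "space gibbs_joint = \<Omega> \<times> \<Omega>"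
  using sets_eq_imp_space_eq[OF sets_gibbs_joint] by (simp add: space_pair_measure)

text \<open>Boundedness gives integrability under the probability measure
  \<open>gibbs_joint\<close>. Through the density \<open>h\<close> this becomes integrability with
  respect to \<open>ref\<close>, possibly an infinite measure, and Fubini applies.\<close>

lemma
  fixes a b :: "real ^ 'd \<Rightarrow> real"
  assumes [measurable]: "a \<in> borel_measurable (borel_of \<Omega>)" "b \<in> borel_measurable (borel_of \<Omega>)"
    and bound: "\<And>x. x \<in> \<Omega> \<Longrightarrow> \<bar>a x\<bar> \<le> K \<and> \<bar>b x\<bar> \<le> K"
  shows integrable_two_valued: "integrable gibbs_joint (\<lambda>(x, z). if z \<in> E then a x else b x)"
    and integral_two_valued: "(\<integral>(x, z). (if z \<in> E then a x else b x) \<partial>gibbs_joint) =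
      (\<integral>x. p x * a x + (1 - p x) * b x \<partial>Phat)"
proof -
  let ?f = "\<lambda>(x, z). if z \<in> E then a x else b x"
  have f: "?f \<in> borel_measurable (borel_of \<Omega> \<Otimes>\<^sub>M borel_of \<Omega>)"
    by measurable
  have "AE xz in gibbs_joint. norm (?f xz) \<le> K"
    using AE_space by eventually_elim (use bound in \<open>auto split: if_splits\<close>)
  then show int: "integrable gibbs_joint ?f"
    using f by (intro joint.integrable_const_bound[of _ K]) auto
  then have int': "integrable (Phat \<Otimes>\<^sub>M lebesgue_of \<Omega>) (\<lambda>xz. h xz * ?f xz)"
    using f unfolding gibbs_joint_def by (subst (asm) integrable_density) (auto simp: ref_def[symmetric])
  have "(\<integral>xz. ?f xz \<partial>gibbs_joint) = (\<integral>xz. h xz * ?f xz \<partial>(Phat \<Otimes>\<^sub>M lebesgue_of \<Omega>))"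
    using f unfolding gibbs_joint_def by (subst integral_density) (auto simp: ref_def[symmetric])
  also have "\<dots> = (\<integral>x. \<integral>z. h (x, z) * ?f (x, z) \<partial>lebesgue_of \<Omega> \<partial>Phat)"
    by (rule pair.integral_fst'[OF int', symmetric])
  also have "\<dots> = (\<integral>x. p x * a x + (1 - p x) * b x \<partial>Phat)"
  proof (rule Bochner_Integration.integral_cong_AE)
    show "(\<lambda>x. \<integral>z. h (x, z) * ?f (x, z) \<partial>lebesgue_of \<Omega>) \<in> borel_measurable Phat"
      using pair.integrable_fst'[OF int'] by auto
    show "AE x in Phat. (\<integral>z. h (x, z) * ?f (x, z) \<partial>lebesgue_of \<Omega>) = p x * a x + (1 - p x) * b x"
      using AE_good
    proof eventually_elim
      case (elim x)
      have "(\<integral>z. h (x, z) * ?f (x, z) \<partial>lebesgue_of \<Omega>) = (\<integral>z. (if z \<in> E then a x else b x) \<partial>gibbs \<Omega> c \<epsilon> x)"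
        using elim by (subst integral_gibbs) auto
      then show ?case
        using elim by (simp add: integral_gibbs_two_valued)
    qed
  qed measurable
  finally show "(\<integral>xz. ?f xz \<partial>gibbs_joint) = (\<integral>x. p x * a x + (1 - p x) * b x \<partial>Phat)" .
qed

section \<open>The Sinkhorn objective on couplings with first marginal \<open>Phat\<close>\<close>

lemma reference_coupling:
  assumes "\<gamma> \<in> couplings \<Omega> Phat P"
  shows "reference \<Omega> \<gamma> = ref"
  using assms by (simp add: couplings_def reference_def ref_def)

text \<open>Cost and entropy stay under one expectation: separately they may be infinite with
  opposite signs, while jointly they combine into the logarithm of a density ratio.\<close>

lemma sinkhorn_objective_coupling:
  assumes "\<gamma> \<in> couplings \<Omega> Phat P" "absolutely_continuous ref \<gamma>"
  shows "sinkhorn_objective \<Omega> c \<epsilon> \<gamma> =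
    ext_expectation \<gamma> (\<lambda>(x, z). c x z + \<epsilon> * ln (enn2real (RN_deriv ref \<gamma> (x, z))))"
  using assms \<epsilon>_pos c_meas
  by (subst sinkhorn_objective_joint)
    (auto simp: couplings_def reference_coupling[OF assms(1)] entropy_density_def log_ln[symmetric] case_prod_unfold)

lemma objective_integrand_measurable:
  assumes "\<gamma> \<in> couplings \<Omega> Phat P"
  shows "(\<lambda>(x, z). c x z + \<epsilon> * ln (enn2real (RN_deriv ref \<gamma> (x, z)))) \<in> borel_measurable \<gamma>"
proof -
  have sets_\<gamma> [measurable_cong]: "sets \<gamma> = sets (borel_of \<Omega> \<Otimes>\<^sub>M borel_of \<Omega>)"
    using assms by (simp add: couplings_def)
  have [measurable]: "RN_deriv ref \<gamma> \<in> borel_measurable \<gamma>"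
    unfolding measurable_cong_sets[OF trans[OF sets_\<gamma> sets_ref[symmetric]] refl] by simp
  show ?thesis
    unfolding case_prod_unfold prod.collapse by measurable
qed

lemma ln_h: "0 < Z x \<Longrightarrow> ln (h (x, z)) = - c x z / \<epsilon> - ln (Z x)"
  by (simp add: h_def ln_div)

lemma
  assumes "\<gamma> \<in> couplings \<Omega> Phat P"
  shows integrable_ln_Z_coupling: "integrable \<gamma> (\<lambda>xz. \<epsilon> * ln (Z (fst xz)))"
    and integral_ln_Z_coupling: "(\<integral>xz. \<epsilon> * ln (Z (fst xz)) \<partial>\<gamma>) = (\<integral>x. \<epsilon> * ln (Z x) \<partial>Phat)"
    and AE_Z_coupling: "AE xz in \<gamma>. 0 < Z (fst xz)"
proof -
  have \<gamma>: "sets \<gamma> = sets (borel_of \<Omega> \<Otimes>\<^sub>M borel_of \<Omega>)" "Phat = distr \<gamma> (borel_of \<Omega>) fst"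
    using assms by (auto simp: couplings_def)
  note \<gamma>(1)[measurable_cong]
  have fst: "fst \<in> measurable \<gamma> (borel_of \<Omega>)"
    by measurable
  have [measurable]: "(\<lambda>x. \<epsilon> * ln (Z x)) \<in> borel_measurable (borel_of \<Omega>)"
    by measurable
  show "integrable \<gamma> (\<lambda>xz. \<epsilon> * ln (Z (fst xz)))"
    using ln_Z unfolding \<gamma>(2) by (rule integrable_distr[OF fst])
  show "(\<integral>xz. \<epsilon> * ln (Z (fst xz)) \<partial>\<gamma>) = (\<integral>x. \<epsilon> * ln (Z x) \<partial>Phat)"
    unfolding \<gamma>(2) by (rule integral_distr[OF fst, symmetric]) measurable
  show "AE xz in \<gamma>. 0 < Z (fst xz)"
    using Z_pos unfolding \<gamma>(2) by (rule AE_distrD[OF fst])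
qed

text \<open>This is the Gibbs variational inequality, obtained from \<open>ln t \<le> t - 1\<close> at
  \<open>t = exp g * h / D\<close>, where \<open>h\<close> and \<open>D\<close> are the densities of \<open>gibbs_joint\<close> and \<open>\<gamma>\<close>.\<close>

lemma sinkhorn_objective_ge:
  fixes g :: "(real ^ 'd) \<times> (real ^ 'd) \<Rightarrow> real"
  assumes \<gamma>: "\<gamma> \<in> couplings \<Omega> Phat P"
    and g [measurable]: "g \<in> borel_measurable (borel_of \<Omega> \<Otimes>\<^sub>M borel_of \<Omega>)"
    and bound: "\<And>xz. xz \<in> \<Omega> \<times> \<Omega> \<Longrightarrow> \<bar>g xz\<bar> \<le> K"
  shows "ereal (\<epsilon> * ((\<integral>xz. g xz \<partial>\<gamma>) + 1 - (\<integral>xz. exp (g xz) \<partial>gibbs_joint)) - (\<integral>x. \<epsilon> * ln (Z x) \<partial>Phat))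
    \<le> sinkhorn_objective \<Omega> c \<epsilon> \<gamma>"
proof (cases "absolutely_continuous ref \<gamma>")
  case False
  then show ?thesis
    by (simp add: sinkhorn_objective_def reference_coupling[OF \<gamma>])
next
  case ac: True
  have sets_\<gamma> [measurable_cong]: "sets \<gamma> = sets (borel_of \<Omega> \<Otimes>\<^sub>M borel_of \<Omega>)"
    using \<gamma> by (simp add: couplings_def)
  then have space_\<gamma>: "space \<gamma> = \<Omega> \<times> \<Omega>"
    using sets_eq_imp_space_eq[OF sets_\<gamma>] by (simp add: space_pair_measure)
  interpret \<gamma>: prob_space \<gamma>
    using \<gamma> by (simp add: couplings_def)
  obtain D where D_ref: "D \<in> borel_measurable ref"
    and RN: "AE xz in ref. RN_deriv ref \<gamma> xz = ennreal (D xz)"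
    and D_pos: "AE xz in \<gamma>. 0 < D xz" and D_nonneg: "\<And>xz. 0 \<le> D xz"
    by (rule ref.real_RN_deriv[OF \<gamma>.finite_measure_axioms ac]) (simp_all add: sets_\<gamma>)
  have D [measurable]: "D \<in> borel_measurable (borel_of \<Omega> \<Otimes>\<^sub>M borel_of \<Omega>)"
    using D_ref by (simp add: measurable_cong_sets[OF sets_ref refl])
  have \<gamma>_eq: "\<gamma> = density ref D"
    using ref.density_RN_deriv[OF ac] RN D_ref
    by (subst density_cong[symmetric, of "RN_deriv ref \<gamma>"]) (auto simp: sets_\<gamma>)
  let ?q = "\<lambda>xz. exp (g xz) * h xz / D xz"
  have g_int: "integrable \<gamma> g"
    using bound AE_space[of \<gamma>] by (intro \<gamma>.integrable_const_bound[of _ K]) (auto simp: space_\<gamma>)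
  have "AE xz in gibbs_joint. norm (exp (g xz)) \<le> exp K"
    using AE_space by eventually_elim (use bound in \<open>force dest: abs_le_D1\<close>)
  then have exp_g_int: "integrable gibbs_joint (\<lambda>xz. exp (g xz))"
    by (intro joint.integrable_const_bound) auto
  have "(\<integral>\<^sup>+xz. ennreal (?q xz) \<partial>\<gamma>) = (\<integral>\<^sup>+xz. ennreal (D xz) * ennreal (?q xz) \<partial>ref)"
    unfolding \<gamma>_eq by (rule nn_integral_density) auto
  \<comment> \<open>\<open>D\<close> cancels where it is positive. Where it vanishes the left
    integrand is 0 and the right one need not be, hence only an inequality.\<close>
  also have "\<dots> \<le> (\<integral>\<^sup>+xz. ennreal (h xz) * ennreal (exp (g xz)) \<partial>ref)"
    using D_nonneg
    by (intro nn_integral_mono) (auto simp: ennreal_mult''[symmetric] intro!: ennreal_leI)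
  also have "\<dots> = (\<integral>\<^sup>+xz. ennreal (exp (g xz)) \<partial>gibbs_joint)"
    unfolding gibbs_joint_def by (rule nn_integral_density[symmetric]) auto
  also have "\<dots> = ennreal (\<integral>xz. exp (g xz) \<partial>gibbs_joint)"
    by (rule nn_integral_eq_integral[OF exp_g_int]) simp
  finally have q_le: "(\<integral>\<^sup>+xz. ennreal (?q xz) \<partial>\<gamma>) \<le> ennreal (\<integral>xz. exp (g xz) \<partial>gibbs_joint)" .
  then have q_int: "integrable \<gamma> ?q"
    using D_nonneg by (intro integrableI_nonneg) (auto intro: le_less_trans)
  then have "(\<integral>xz. ?q xz \<partial>\<gamma>) \<le> (\<integral>xz. exp (g xz) \<partial>gibbs_joint)"
    using q_le D_nonneg by (subst (asm) nn_integral_eq_integral) auto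
  then have "\<epsilon> * ((\<integral>xz. g xz \<partial>\<gamma>) + 1 - (\<integral>xz. exp (g xz) \<partial>gibbs_joint)) - (\<integral>x. \<epsilon> * ln (Z x) \<partial>Phat)
      \<le> \<epsilon> * ((\<integral>xz. g xz \<partial>\<gamma>) + 1 - (\<integral>xz. ?q xz \<partial>\<gamma>)) - (\<integral>x. \<epsilon> * ln (Z x) \<partial>Phat)"
    using \<epsilon>_pos by simp
  also have "\<dots> = (\<integral>xz. \<epsilon> * (g xz + 1 - ?q xz) - \<epsilon> * ln (Z (fst xz)) \<partial>\<gamma>)"
    using g_int q_int integrable_ln_Z_coupling[OF \<gamma>]
    by (subst integral_ln_Z_coupling[OF \<gamma>, symmetric]) (simp add: \<gamma>.prob_space)
  finally have "ereal (\<epsilon> * ((\<integral>xz. g xz \<partial>\<gamma>) + 1 - (\<integral>xz. exp (g xz) \<partial>gibbs_joint)) - (\<integral>x. \<epsilon> * ln (Z x) \<partial>Phat))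
      \<le> ereal (\<integral>xz. \<epsilon> * (g xz + 1 - ?q xz) - \<epsilon> * ln (Z (fst xz)) \<partial>\<gamma>)"
    by simp
  \<comment> \<open>Neither the cost nor the log-density need be integrable under
    \<open>\<gamma>\<close>, so the comparison runs through an integrable minorant.\<close>
  also have "\<dots> \<le> sinkhorn_objective \<Omega> c \<epsilon> \<gamma>"
    unfolding sinkhorn_objective_coupling[OF \<gamma> ac]
  proof (rule ext_expectation_ge)
    show "integrable \<gamma> (\<lambda>xz. \<epsilon> * (g xz + 1 - ?q xz) - \<epsilon> * ln (Z (fst xz)))"
      using g_int q_int integrable_ln_Z_coupling[OF \<gamma>] by simp
    show "(\<lambda>(x, z). c x z + \<epsilon> * ln (enn2real (RN_deriv ref \<gamma> (x, z)))) \<in> borel_measurable \<gamma>"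
      by (rule objective_integrand_measurable[OF \<gamma>])
    have "AE xz in \<gamma>. RN_deriv ref \<gamma> xz = ennreal (D xz)"
      using absolutely_continuous_AE[OF _ ac RN] sets_\<gamma> by simp
    with D_pos AE_Z_coupling[OF \<gamma>]
    show "AE xz in \<gamma>. \<epsilon> * (g xz + 1 - ?q xz) - \<epsilon> * ln (Z (fst xz)) \<le>
        (case xz of (x, z) \<Rightarrow> c x z + \<epsilon> * ln (enn2real (RN_deriv ref \<gamma> (x, z))))"
    proof eventually_elim
      case (elim xz)
      obtain x z where xz: "xz = (x, z)"
        by fastforce
      have h_pos: "0 < h xz"
        using elim by (simp add: xz h_def)
      have "ln (?q xz) = g xz - c x z / \<epsilon> - ln (Z x) - ln (D xz)"
        using elim h_pos by (simp add: ln_div ln_mult xz ln_h)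
      moreover have "ln (?q xz) \<le> ?q xz - 1"
        using elim h_pos by (intro ln_le_minus_one) simp
      ultimately have "\<epsilon> * (g xz + 1 - ?q xz - ln (Z x)) \<le> \<epsilon> * (c x z / \<epsilon> + ln (D xz))"
        using \<epsilon>_pos by (intro mult_left_mono) auto
      then show ?case
        using elim \<epsilon>_pos by (simp add: xz algebra_simps)
    qed
  qed
  finally show ?thesis .
qed

section \<open>Bounds on the Sinkhorn discrepancy in both directions\<close>

lemma integrable_bounded_Phat:
  fixes f :: "real ^ 'd \<Rightarrow> real"
  assumes "f \<in> borel_measurable (borel_of \<Omega>)" "\<And>x. x \<in> \<Omega> \<Longrightarrow> \<bar>f x\<bar> \<le> K"
  shows "integrable Phat f"
proof (rule Phat.integrable_const_bound)
  show "AE x in Phat. norm (f x) \<le> K"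
    using AE_space by eventually_elim (use assms(2) in simp)
qed (use assms(1) in measurable)

lemma integrable_p: "integrable Phat p"
  by (rule integrable_bounded_Phat[of _ 1]) (use p_bounds in auto)

lemma integrable_variance: "integrable Phat (\<lambda>x. p x * (1 - p x))"
  by (rule integrable_bounded_Phat[of _ 1])
    (use p_bounds in \<open>auto simp: abs_mult intro!: mult_le_one\<close>)

lemma measure_snd_coupling:
  assumes "\<gamma> \<in> couplings \<Omega> Phat P"
  shows "measure P E = (\<integral>xz. indicator E (snd xz) \<partial>\<gamma>)"
proof -
  have \<gamma>: "sets \<gamma> = sets (borel_of \<Omega> \<Otimes>\<^sub>M borel_of \<Omega>)" "P = distr \<gamma> (borel_of \<Omega>) snd"
    using assms by (auto simp: couplings_def)
  note \<gamma>(1)[measurable_cong]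
  have "(\<integral>xz. indicator E (snd xz) \<partial>\<gamma>) = (\<integral>z. (indicator E z :: real) \<partial>P)"
    unfolding \<gamma>(2) by (rule integral_distr[symmetric]) measurable
  also have "\<dots> = measure P E"
    using E_sub by (simp add: \<gamma>(2) Int_absorb2)
  finally show ?thesis ..
qed

text \<open>The variational inequality is applied to \<open>l * (indicator E z - p x)\<close>. The
  mean of this function under a coupling is fixed by the marginals, so the bound is the same for all
  couplings and passes to the infimum. The condition \<open>l \<le> 1\<close> keeps the function in
  the range of the exponential bound.\<close>

lemma sinkhorn_ge:
  assumes l: "0 \<le> l" "l \<le> 1"
  shows "ereal (\<epsilon> * (l * (measure P E - (\<integral>x. p x \<partial>Phat)) - (l\<^sup>2 / 2 + l ^ 3) * sigma_sq \<Omega> c E Phat \<epsilon>)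
      - (\<integral>x. \<epsilon> * ln (Z x) \<partial>Phat)) \<le> sinkhorn \<Omega> c \<epsilon> Phat P"
  unfolding sinkhorn_def
proof (rule INF_greatest)
  fix \<gamma> assume \<gamma>: "\<gamma> \<in> couplings \<Omega> Phat P"
  have sets_\<gamma> [measurable_cong]: "sets \<gamma> = sets (borel_of \<Omega> \<Otimes>\<^sub>M borel_of \<Omega>)"
    using \<gamma> by (simp add: couplings_def)
  have fst: "distr \<gamma> (borel_of \<Omega>) fst = Phat"
    using \<gamma> by (simp add: couplings_def)
  interpret \<gamma>: prob_space \<gamma>
    using \<gamma> by (simp add: couplings_def)
  let ?a = "\<lambda>x. l * (1 - p x)" and ?b = "\<lambda>x. l * (0 - p x)"
  let ?g = "\<lambda>(x, z). if z \<in> E then ?a x else ?b x"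
  let ?V = "sigma_sq \<Omega> c E Phat \<epsilon>"
  have ab: "\<bar>?a x\<bar> \<le> l" "\<bar>?b x\<bar> \<le> l" if "x \<in> \<Omega>" for x
    using p_bounds[OF that] l by (auto simp: abs_mult intro: mult_left_le)
  have exp_ab: "\<bar>exp (?a x)\<bar> \<le> exp 1" "\<bar>exp (?b x)\<bar> \<le> exp 1" if "x \<in> \<Omega>" for x
    using ab[OF that] l by auto
  have g: "?g \<in> borel_measurable (borel_of \<Omega> \<Otimes>\<^sub>M borel_of \<Omega>)"
    by measurable
  have p_int: "integrable \<gamma> (\<lambda>xz. p (fst xz))"
    using integrable_p unfolding fst[symmetric] by (rule integrable_distr[rotated]) measurable
  have "(\<integral>xz. ?g xz \<partial>\<gamma>) = (\<integral>xz. l * indicator E (snd xz) - l * p (fst xz) \<partial>\<gamma>)"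
    by (intro Bochner_Integration.integral_cong) (auto simp: algebra_simps)
  also have "\<dots> = l * (\<integral>xz. indicator E (snd xz) \<partial>\<gamma>) - l * (\<integral>xz. p (fst xz) \<partial>\<gamma>)"
    using p_int by (subst Bochner_Integration.integral_diff)
      (auto intro!: \<gamma>.integrable_const_bound[of _ 1])
  also have "(\<integral>xz. p (fst xz) \<partial>\<gamma>) = (\<integral>x. p x \<partial>Phat)"
    unfolding fst[symmetric] by (rule integral_distr[symmetric]) measurable
  finally have g_eq: "(\<integral>xz. ?g xz \<partial>\<gamma>) = l * (measure P E - (\<integral>x. p x \<partial>Phat))"
    by (simp add: measure_snd_coupling[OF \<gamma>] algebra_simps)
  have "(\<integral>xz. exp (?g xz) \<partial>gibbs_joint) =
      (\<integral>(x, z). (if z \<in> E then exp (?a x) else exp (?b x)) \<partial>gibbs_joint)"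
    by (intro Bochner_Integration.integral_cong) auto
  also have "\<dots> = (\<integral>x. p x * exp (?a x) + (1 - p x) * exp (?b x) \<partial>Phat)"
    using exp_ab by (intro integral_two_valued[of _ _ "exp 1"]) auto
  also have "\<dots> \<le> (\<integral>x. 1 + (l\<^sup>2 / 2 + l ^ 3) * (p x * (1 - p x)) \<partial>Phat)"
  proof (rule integral_mono_AE)
    show "integrable Phat (\<lambda>x. p x * exp (?a x) + (1 - p x) * exp (?b x))"
    proof (rule integrable_bounded_Phat)
      fix x assume x: "x \<in> \<Omega>"
      show "\<bar>p x * exp (?a x) + (1 - p x) * exp (?b x)\<bar> \<le> exp 1"
        using convex_bound_le[of "exp (?a x)" "exp 1" "exp (?b x)" "p x" "1 - p x"]
          exp_ab[OF x] p_bounds[OF x] by simp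
    qed measurable
    show "AE x in Phat. p x * exp (?a x) + (1 - p x) * exp (?b x) \<le>
        1 + (l\<^sup>2 / 2 + l ^ 3) * (p x * (1 - p x))"
      using AE_space
    proof eventually_elim
      case (elim x)
      then have "0 \<le> p x" "p x \<le> 1"
        using p_bounds[of x] by auto
      then show ?case
        using l by (intro centred_bernoulli_mean_le exp_le_quadratic_plus_cubic) auto
    qed
  qed (use integrable_variance in simp)
  also have "\<dots> = 1 + (l\<^sup>2 / 2 + l ^ 3) * ?V"
    using integrable_variance by (simp add: sigma_sq_eq del: power_Suc)
  finally have "\<epsilon> * (l * (measure P E - (\<integral>x. p x \<partial>Phat)) - (l\<^sup>2 / 2 + l ^ 3) * ?V) - (\<integral>x. \<epsilon> * ln (Z x) \<partial>Phat) \<le>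
      \<epsilon> * ((\<integral>xz. ?g xz \<partial>\<gamma>) + 1 - (\<integral>xz. exp (?g xz) \<partial>gibbs_joint)) - (\<integral>x. \<epsilon> * ln (Z x) \<partial>Phat)"
    unfolding g_eq using \<epsilon>_pos by (intro diff_right_mono mult_left_mono) auto
  also have "ereal \<dots> \<le> sinkhorn_objective \<Omega> c \<epsilon> \<gamma>"
    using ab by (intro sinkhorn_objective_ge[OF \<gamma> g, of l]) (auto split: if_splits)
  finally show "ereal (\<epsilon> * (l * (measure P E - (\<integral>x. p x \<partial>Phat)) - (l\<^sup>2 / 2 + l ^ 3) * ?V)
      - (\<integral>x. \<epsilon> * ln (Z x) \<partial>Phat)) \<le> sinkhorn_objective \<Omega> c \<epsilon> \<gamma>"
    by simp
qed

text \<open>A linear rather than exponential tilt of \<open>gibbs_joint\<close> keeps the first marginal without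
  normalisation.\<close>

lemma exists_sinkhorn_le:
  assumes l: "0 \<le> l" "l \<le> 1 / 2"
  obtains P where "prob_measure_on \<Omega> P"
    and "measure P E = (\<integral>x. p x \<partial>Phat) + l * sigma_sq \<Omega> c E Phat \<epsilon>"
    and "sinkhorn \<Omega> c \<epsilon> Phat P \<le>
      ereal (\<epsilon> * ((l\<^sup>2 / 2 + l ^ 3) * sigma_sq \<Omega> c E Phat \<epsilon>) - (\<integral>x. \<epsilon> * ln (Z x) \<partial>Phat))"
proof -
  let ?a = "\<lambda>x. l * (1 - p x)" and ?b = "\<lambda>x. l * (0 - p x)"
  let ?V = "sigma_sq \<Omega> c E Phat \<epsilon>"
  \<comment> \<open>This is \<open>1 + l * (indicator E z - p x)\<close>. Since
    \<open>l \<le> 1 / 2\<close>, it lies between \<open>1 / 2\<close> and \<open>3 / 2\<close> on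
    \<open>\<Omega> \<times> \<Omega>\<close>, so its logarithm is bounded.\<close>
  define w where "w = (\<lambda>(x, z). if z \<in> E then 1 + ?a x else 1 + ?b x)"
  define \<gamma> where "\<gamma> = density gibbs_joint w"
  define P where "P = distr \<gamma> (borel_of \<Omega>) snd"
  have ab: "\<bar>?a x\<bar> \<le> 1 / 2" "\<bar>?b x\<bar> \<le> 1 / 2" if "x \<in> \<Omega>" for x
  proof -
    have "\<bar>?a x\<bar> \<le> l" "\<bar>?b x\<bar> \<le> l"
      using p_bounds[OF that] l by (auto simp: abs_mult intro: mult_left_le)
    then show "\<bar>?a x\<bar> \<le> 1 / 2" "\<bar>?b x\<bar> \<le> 1 / 2"
      using l by auto
  qed
  have w [measurable]: "w \<in> borel_measurable (borel_of \<Omega> \<Otimes>\<^sub>M borel_of \<Omega>)"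
    unfolding w_def by measurable
  have w_pos: "0 < w xz" if "xz \<in> \<Omega> \<times> \<Omega>" for xz
    using that ab[of "fst xz"] by (auto simp: w_def abs_le_iff)
  have sets_\<gamma> [measurable_cong, simp]: "sets \<gamma> = sets (borel_of \<Omega> \<Otimes>\<^sub>M borel_of \<Omega>)"
    by (simp add: \<gamma>_def)
  have space_\<gamma>: "space \<gamma> = \<Omega> \<times> \<Omega>"
    by (simp add: \<gamma>_def)
  have w_nonneg: "AE xz in gibbs_joint. 0 \<le> w xz"
    using AE_space by eventually_elim (use w_pos in \<open>auto intro: less_imp_le\<close>)

  \<comment> \<open>The weight \<open>w\<close> is itself two-valued in \<open>z\<close>, so the
    reduction to integrals over \<open>Phat\<close> carries over from \<open>gibbs_joint\<close> to
    \<open>\<gamma>\<close>.\<close>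
  have two_valued: "integrable \<gamma> (\<lambda>(x, z). if z \<in> E then u x else v x) \<and>
      (\<integral>(x, z). (if z \<in> E then u x else v x) \<partial>\<gamma>) =
      (\<integral>x. p x * ((1 + ?a x) * u x) + (1 - p x) * ((1 + ?b x) * v x) \<partial>Phat)"
    if [measurable]: "u \<in> borel_measurable (borel_of \<Omega>)" "v \<in> borel_measurable (borel_of \<Omega>)"
      and K: "\<And>x. x \<in> \<Omega> \<Longrightarrow> \<bar>u x\<bar> \<le> K \<and> \<bar>v x\<bar> \<le> K" for u v K
  proof -
    have bound: "\<bar>(1 + ?a x) * u x\<bar> \<le> 2 * K \<and> \<bar>(1 + ?b x) * v x\<bar> \<le> 2 * K" if "x \<in> \<Omega>" for x
      unfolding abs_mult using ab[OF that] K[OF that] by (intro conjI mult_mono) auto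
    have eq: "w xz * (case xz of (x, z) \<Rightarrow> if z \<in> E then u x else v x) =
        (case xz of (x, z) \<Rightarrow> if z \<in> E then (1 + ?a x) * u x else (1 + ?b x) * v x)" for xz
      by (simp add: w_def split: prod.split)
    have "integrable gibbs_joint (\<lambda>(x, z). if z \<in> E then (1 + ?a x) * u x else (1 + ?b x) * v x)"
      using bound by (intro integrable_two_valued[of _ _ "2 * K"]) auto
    moreover have "(\<integral>(x, z). (if z \<in> E then (1 + ?a x) * u x else (1 + ?b x) * v x) \<partial>gibbs_joint) =
        (\<integral>x. p x * ((1 + ?a x) * u x) + (1 - p x) * ((1 + ?b x) * v x) \<partial>Phat)"
      using bound by (intro integral_two_valued[of _ _ "2 * K"]) auto
    ultimately show ?thesis
      unfolding \<gamma>_def using w_nonneg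
      by (subst integrable_density, measurable, subst integral_density, measurable)
        (simp only: eq real_scaleR_def)
  qed

  \<comment> \<open>A function of \<open>x\<close> alone is two-valued with equal values, and
    \<open>p x * ?a x + (1 - p x) * ?b x = 0\<close> makes the conditional mean of \<open>w\<close>
    equal to 1. This yields both the total mass of \<open>\<gamma>\<close> and its first
    marginal.\<close>
  have fst_eq: "(\<integral>xz. u (fst xz) \<partial>\<gamma>) = (\<integral>x. u x \<partial>Phat)"
    if "u \<in> borel_measurable (borel_of \<Omega>)" "\<And>x. x \<in> \<Omega> \<Longrightarrow> \<bar>u x\<bar> \<le> K" for u :: "real ^ 'd \<Rightarrow> real" and K
  proof -
    have "(\<integral>xz. u (fst xz) \<partial>\<gamma>) = (\<integral>(x, z). (if z \<in> E then u x else u x) \<partial>\<gamma>)"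
      by (simp add: case_prod_unfold)
    also have "\<dots> = (\<integral>x. u x \<partial>Phat)"
      using that by (subst two_valued[of u u K, THEN conjunct2])
        (auto intro!: Bochner_Integration.integral_cong simp: algebra_simps)
    finally show ?thesis .
  qed

  have "integrable gibbs_joint w"
    unfolding w_def using ab by (intro integrable_two_valued[of _ _ 2]) force+
  then have "emeasure \<gamma> (space \<gamma>) = ennreal (\<integral>xz. w xz \<partial>gibbs_joint)"
    unfolding \<gamma>_def using w_nonneg sets.top[of gibbs_joint]
    by (subst emeasure_density) (auto simp: nn_integral_eq_integral[symmetric] intro!: nn_integral_cong)
  also have "(\<integral>xz. w xz \<partial>gibbs_joint) = (\<integral>xz. 1 \<partial>\<gamma>)"
    unfolding \<gamma>_def using w_nonneg by (subst integral_density) auto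
  also have "\<dots> = 1"
    using fst_eq[of "\<lambda>_. 1" 1] by (simp add: Phat.prob_space)
  finally interpret \<gamma>: prob_space \<gamma>
    by (intro prob_spaceI) simp
  interpret P: prob_space P
    unfolding P_def by (rule \<gamma>.prob_space_distr) measurable

  have "distr \<gamma> (borel_of \<Omega>) fst = Phat"
  proof (rule measure_eqI)
    fix A assume "A \<in> sets (distr \<gamma> (borel_of \<Omega>) fst)"
    then have A [measurable]: "A \<in> sets (borel_of \<Omega>)"
      by simp
    have "measure (distr \<gamma> (borel_of \<Omega>) fst) A = (\<integral>x. indicator A x \<partial>distr \<gamma> (borel_of \<Omega>) fst)"
      using sets.sets_into_space[OF A] by (simp add: Int_absorb2)
    also have "\<dots> = (\<integral>xz. indicator A (fst xz) \<partial>\<gamma>)"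
      by (rule integral_distr) measurable
    also have "\<dots> = (\<integral>x. indicator A x \<partial>Phat)"
      by (rule fst_eq[of _ 1]) (auto simp: indicator_def)
    also have "\<dots> = measure Phat A"
      using sets.sets_into_space[OF A] by (simp add: Int_absorb2)
    finally have "measure (distr \<gamma> (borel_of \<Omega>) fst) A = measure Phat A" .
    moreover have "prob_space (distr \<gamma> (borel_of \<Omega>) fst)"
      by (rule \<gamma>.prob_space_distr) measurable
    ultimately show "emeasure (distr \<gamma> (borel_of \<Omega>) fst) A = emeasure Phat A"
      by (simp add: Phat.emeasure_eq_measure finite_measure.emeasure_eq_measure prob_space.finite_measure)
  qed simp
  then have \<gamma>: "\<gamma> \<in> couplings \<Omega> Phat P"
    by (simp add: couplings_def P_def \<gamma>.prob_space_axioms)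

  have \<gamma>_eq: "\<gamma> = density ref (\<lambda>xz. ennreal (h xz) * ennreal (w xz))"
    unfolding \<gamma>_def gibbs_joint_def by (rule density_density_eq) auto
  then have ac: "absolutely_continuous ref \<gamma>"
    by (simp add: absolutely_continuousI_density)
  have "AE xz in ref. ennreal (h xz) * ennreal (w xz) = RN_deriv ref \<gamma> xz"
    by (rule ref.RN_deriv_unique) (auto simp: \<gamma>_eq)
  then have "AE xz in \<gamma>. ennreal (h xz) * ennreal (w xz) = RN_deriv ref \<gamma> xz"
    by (rule absolutely_continuous_AE[OF _ ac, rotated]) simp
  \<comment> \<open>The cost cancels against the exponent in \<open>ln (h xz)\<close>; what remains
    is the log-density relative to \<open>gibbs_joint\<close> and the partition function.\<close>
  then have integrand: "AE xz in \<gamma>. (case xz of (x, z) \<Rightarrow> c x z + \<epsilon> * ln (enn2real (RN_deriv ref \<gamma> (x, z)))) =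
      \<epsilon> * ln (w xz) - \<epsilon> * ln (Z (fst xz))"
    using AE_Z_coupling[OF \<gamma>] AE_space
  proof eventually_elim
    case (elim xz)
    obtain x z where xz: "xz = (x, z)"
      by fastforce
    have "enn2real (RN_deriv ref \<gamma> xz) = h xz * w xz"
      using w_pos[of xz] elim by (simp add: space_\<gamma> ennreal_mult''[symmetric] flip: elim(1))
    then have "ln (enn2real (RN_deriv ref \<gamma> xz)) = ln (w xz) - c x z / \<epsilon> - ln (Z x)"
      using w_pos[of xz] elim by (simp add: space_\<gamma> xz ln_mult ln_h) (simp add: h_def)
    then show ?case
      using \<epsilon>_pos by (simp add: xz right_diff_distrib)
  qed
  \<comment> \<open>The divergence integrates \<open>ln w\<close> against \<open>\<gamma>\<close>,
    which brings in a factor \<open>w\<close>; hence \<open>(1 + u) * ln (1 + u)\<close>.\<close>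
  let ?f = "\<lambda>u. (1 + u) * ln (1 + u)"
  \<comment> \<open>This follows from \<open>\<bar>ln (1 + u) - u\<bar> \<le> 2 * u\<^sup>2\<close>,
    as \<open>1 / 2 + 2 * (1 / 4) = 1\<close>.\<close>
  have ln_bound: "\<bar>ln (1 + u)\<bar> \<le> 1" if "\<bar>u\<bar> \<le> 1 / 2" for u :: real
  proof -
    have "\<bar>u\<bar>\<^sup>2 \<le> (1 / 2)\<^sup>2"
      using that by (intro power_mono) auto
    then show ?thesis
      using abs_ln_one_plus_x_minus_x_bound[OF that] that by (simp add: power2_eq_square)
  qed
  have ln_w: "ln (w xz) = (case xz of (x, z) \<Rightarrow> if z \<in> E then ln (1 + ?a x) else ln (1 + ?b x))" for xz
    by (simp add: w_def split: prod.split)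
  have "integrable \<gamma> (\<lambda>(x, z). if z \<in> E then ln (1 + ?a x) else ln (1 + ?b x)) \<and>
      (\<integral>(x, z). (if z \<in> E then ln (1 + ?a x) else ln (1 + ?b x)) \<partial>\<gamma>) =
      (\<integral>x. p x * ?f (?a x) + (1 - p x) * ?f (?b x) \<partial>Phat)"
    using ab by (intro two_valued[of _ _ 1] conjI ln_bound) auto
  then have ln_w_int: "integrable \<gamma> (\<lambda>xz. ln (w xz))"
    and ln_w_eq: "(\<integral>xz. ln (w xz) \<partial>\<gamma>) = (\<integral>x. p x * ?f (?a x) + (1 - p x) * ?f (?b x) \<partial>Phat)"
    by (simp_all only: ln_w)
  note ln_w_eq
  also have "(\<integral>x. p x * ?f (?a x) + (1 - p x) * ?f (?b x) \<partial>Phat) \<le>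
      (\<integral>x. 0 + (l\<^sup>2 / 2 + l ^ 3) * (p x * (1 - p x)) \<partial>Phat)"
  proof (rule integral_mono_AE)
    show "integrable Phat (\<lambda>x. p x * ?f (?a x) + (1 - p x) * ?f (?b x))"
    proof (rule integrable_bounded_Phat)
      fix x assume x: "x \<in> \<Omega>"
      have f_bound: "\<bar>?f u\<bar> \<le> 2" if "\<bar>u\<bar> \<le> 1 / 2" for u :: real
        using that ln_bound[OF that] mult_mono[of "\<bar>1 + u\<bar>" 2 "\<bar>ln (1 + u)\<bar>" 1] by (auto simp: abs_mult)
      have "\<bar>p x * ?f (?a x)\<bar> \<le> 1 * 2" "\<bar>(1 - p x) * ?f (?b x)\<bar> \<le> 1 * 2"
        unfolding abs_mult[of "p x"] abs_mult[of "1 - p x"]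
        using f_bound[OF ab(1)[OF x]] f_bound[OF ab(2)[OF x]] p_bounds[OF x]
        by (intro mult_mono; simp)+
      then show "\<bar>p x * ?f (?a x) + (1 - p x) * ?f (?b x)\<bar> \<le> 4"
        by linarith
    qed measurable
    show "AE x in Phat. p x * ?f (?a x) + (1 - p x) * ?f (?b x) \<le> 0 + (l\<^sup>2 / 2 + l ^ 3) * (p x * (1 - p x))"
      using AE_space
    proof eventually_elim
      case (elim x)
      then have "0 \<le> p x" "p x \<le> 1"
        using p_bounds[of x] by auto
      moreover have "?f u \<le> 0 + u + u\<^sup>2 / 2 + \<bar>u\<bar> * u\<^sup>2" if "\<bar>u\<bar> \<le> l" for u
        using entropy_le_quadratic_plus_cubic[of u] that l by simp
      ultimately show ?case
        using l by (intro centred_bernoulli_mean_le[of l ?f]) auto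
    qed
  qed (use integrable_variance in simp)
  also have "\<dots> = (l\<^sup>2 / 2 + l ^ 3) * ?V"
    by (simp add: sigma_sq_eq)
  finally have KL_le: "(\<integral>xz. ln (w xz) \<partial>\<gamma>) \<le> (l\<^sup>2 / 2 + l ^ 3) * ?V" .
  have int: "integrable \<gamma> (\<lambda>xz. \<epsilon> * ln (w xz) - \<epsilon> * ln (Z (fst xz)))"
    by (intro Bochner_Integration.integrable_diff integrable_mult_right ln_w_int integrable_ln_Z_coupling[OF \<gamma>])
  have meas: "(\<lambda>xz. \<epsilon> * ln (w xz) - \<epsilon> * ln (Z (fst xz))) \<in> borel_measurable \<gamma>"
    using int by (rule borel_measurable_integrable)
  have "sinkhorn_objective \<Omega> c \<epsilon> \<gamma> = ereal (\<integral>xz. \<epsilon> * ln (w xz) - \<epsilon> * ln (Z (fst xz)) \<partial>\<gamma>)"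
    unfolding sinkhorn_objective_coupling[OF \<gamma> ac]
    using int integrand
    by (subst ext_expectation_integrable)
      (simp_all add: integrable_cong_AE[OF objective_integrand_measurable[OF \<gamma>] meas integrand]
        Bochner_Integration.integral_cong_AE[OF objective_integrand_measurable[OF \<gamma>] meas integrand])
  also have "(\<integral>xz. \<epsilon> * ln (w xz) - \<epsilon> * ln (Z (fst xz)) \<partial>\<gamma>) =
      \<epsilon> * (\<integral>xz. ln (w xz) \<partial>\<gamma>) - (\<integral>x. \<epsilon> * ln (Z x) \<partial>Phat)"
    using integrable_ln_Z_coupling[OF \<gamma>] ln_w_int
    by (subst integral_ln_Z_coupling[OF \<gamma>, symmetric]) simp
  finally have "sinkhorn_objective \<Omega> c \<epsilon> \<gamma> \<le>
      ereal (\<epsilon> * ((l\<^sup>2 / 2 + l ^ 3) * ?V) - (\<integral>x. \<epsilon> * ln (Z x) \<partial>Phat))"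
    using KL_le \<epsilon>_pos by simp
  then have "sinkhorn \<Omega> c \<epsilon> Phat P \<le>
      ereal (\<epsilon> * ((l\<^sup>2 / 2 + l ^ 3) * ?V) - (\<integral>x. \<epsilon> * ln (Z x) \<partial>Phat))"
    unfolding sinkhorn_def using \<gamma> by (rule INF_lower2[rotated])
  moreover have "measure P E = (\<integral>x. p x \<partial>Phat) + l * ?V"
  proof -
    have "measure P E = (\<integral>(x, z). (if z \<in> E then 1 else 0) \<partial>\<gamma>)"
      unfolding measure_snd_coupling[OF \<gamma>]
      by (intro Bochner_Integration.integral_cong) (auto simp: indicator_def)
    also have "\<dots> = (\<integral>x. p x + l * (p x * (1 - p x)) \<partial>Phat)"
      by (subst two_valued[of "\<lambda>_. 1" "\<lambda>_. 0" 1, THEN conjunct2])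
        (auto intro!: Bochner_Integration.integral_cong simp: algebra_simps)
    also have "\<dots> = (\<integral>x. p x \<partial>Phat) + l * ?V"
      using integrable_p integrable_variance by (simp add: sigma_sq_eq)
    finally show ?thesis .
  qed
  moreover have "prob_measure_on \<Omega> P"
    by (simp add: prob_measure_on_def P.prob_space_axioms) (simp add: P_def)
  ultimately show thesis
    using that by blast
qed

section \<open>Matching the two bounds at the optimal multiplier\<close>

text \<open>The multiplier \<open>l = s / t\<close> minimises the leading part
  \<open>r / l + l * ?V / 2\<close> of the upper bound. The hypothesis
  \<open>2 * r \<le> sigma_sq \<Omega> c E Phat \<epsilon>\<close> says exactly that this
  \<open>l\<close> is at most 1.\<close>

lemma worst_case_expansion:
  fixes \<rho> :: real
  defines "r \<equiv> modified_radius \<Omega> c Phat \<epsilon> \<rho> / \<epsilon>"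
  assumes r: "0 < r" "2 * r \<le> sigma_sq \<Omega> c E Phat \<epsilon>"
  shows "\<bar>(SUP P \<in> {P. prob_measure_on \<Omega> P \<and> sinkhorn \<Omega> c \<epsilon> Phat P \<le> ereal \<rho>}. measure P E)
    - ((\<integral>x. p x \<partial>Phat) + sqrt (2 * r) * sqrt (sigma_sq \<Omega> c E Phat \<epsilon>))\<bar> \<le> 2 * r"
proof -
  let ?V = "sigma_sq \<Omega> c E Phat \<epsilon>"
  let ?S = "{P. prob_measure_on \<Omega> P \<and> sinkhorn \<Omega> c \<epsilon> Phat P \<le> ereal \<rho>}"
  define s t l where "s = sqrt (2 * r)" and "t = sqrt ?V" and "l = s / t"
  have s: "0 < s" "s\<^sup>2 = 2 * r" and t: "0 < t" "t\<^sup>2 = ?V" and "s \<le> t"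
    using r by (auto simp: s_def t_def)
  then have l: "0 < l" "l \<le> 1"
    by (auto simp: l_def)
  have lV: "l * ?V = s * t" "l\<^sup>2 * ?V = 2 * r" "r / l = s * t / 2"
    using s t unfolding t(2)[symmetric] by (auto simp: l_def field_simps power2_eq_square)
  have radius: "\<epsilon> * r = \<rho> + (\<integral>x. \<epsilon> * ln (Z x) \<partial>Phat)"
    using \<epsilon>_pos by (simp add: r_def modified_radius_def)

  have upper: "measure P E \<le> (\<integral>x. p x \<partial>Phat) + s * t + 2 * r" if "P \<in> ?S" for P
  proof -
    have "ereal (\<epsilon> * (l * (measure P E - (\<integral>x. p x \<partial>Phat)) - (l\<^sup>2 / 2 + l ^ 3) * ?V)
        - (\<integral>x. \<epsilon> * ln (Z x) \<partial>Phat)) \<le> ereal \<rho>"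
      by (rule order_trans[OF sinkhorn_ge]) (use l that in auto)
    then have "\<epsilon> * (l * (measure P E - (\<integral>x. p x \<partial>Phat)) - (l\<^sup>2 / 2 + l ^ 3) * ?V) \<le> \<epsilon> * r"
      by (simp add: radius)
    then have "l * (measure P E - (\<integral>x. p x \<partial>Phat)) \<le> r + (l\<^sup>2 / 2 + l ^ 3) * ?V"
      using \<epsilon>_pos by simp
    also have "(l\<^sup>2 / 2 + l ^ 3) * ?V = (l\<^sup>2 * ?V) / 2 + l * (l\<^sup>2 * ?V)"
      by (simp add: algebra_simps power2_eq_square power3_eq_cube)
    \<comment> \<open>By \<open>l\<^sup>2 * ?V = 2 * r\<close> the two leading terms are both
      \<open>r\<close>, and the cubic term is the whole error.\<close>
    also have "r + \<dots> = l * (2 * (r / l) + 2 * r)"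
      using l by (simp add: lV(2) field_simps)
    finally show ?thesis
      using l by (simp add: lV(3))
  qed

  obtain P where P: "P \<in> ?S" "(\<integral>x. p x \<partial>Phat) + s * t - 2 * r \<le> measure P E"
  proof -
    \<comment> \<open>The factor \<open>1 - l\<close> absorbs the cubic term of the divergence, since
      \<open>(1 - l)\<^sup>2 * (1 + 2 * l) \<le> 1\<close>.\<close>
    let ?l = "l * (1 - l)"
    \<comment> \<open>Completing the square shows \<open>?l \<le> 1 / 4\<close>, well inside the
      range in which the tilt is available.\<close>
    have l_eq: "?l = 1 / 4 - (l - 1 / 2)\<^sup>2"
      by (simp add: field_simps power2_eq_square)
    have "?l \<le> 1 / 2"
      using zero_le_power2[of "l - 1 / 2"] unfolding l_eq by linarith
    then have le: "0 \<le> ?l" "?l \<le> 1 / 2" "?l \<le> l"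
      using l by (auto intro: mult_left_le)
    obtain P where P: "prob_measure_on \<Omega> P" "measure P E = (\<integral>x. p x \<partial>Phat) + ?l * ?V"
      and le_P: "sinkhorn \<Omega> c \<epsilon> Phat P \<le>
        ereal (\<epsilon> * ((?l\<^sup>2 / 2 + ?l ^ 3) * ?V) - (\<integral>x. \<epsilon> * ln (Z x) \<partial>Phat))"
      using exists_sinkhorn_le[OF le(1,2)] by blast
    have "?l\<^sup>2 / 2 + ?l ^ 3 = l\<^sup>2 / 2 * ((1 - l)\<^sup>2 * (1 + 2 * ?l))"
      by (simp add: field_simps power2_eq_square power3_eq_cube)
    also have "\<dots> \<le> l\<^sup>2 / 2 * ((1 - l)\<^sup>2 * (1 + 2 * l))"
      using le by (intro mult_left_mono) auto
    also have "\<dots> = l\<^sup>2 / 2 * (1 - l\<^sup>2 * (3 - 2 * l))"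
      by (simp add: algebra_simps power2_eq_square)
    also have "\<dots> \<le> l\<^sup>2 / 2 * 1"
      using l by (intro mult_left_mono) auto
    finally have "(?l\<^sup>2 / 2 + ?l ^ 3) * ?V \<le> l\<^sup>2 / 2 * 1 * ?V"
      by (rule mult_right_mono) (simp add: t(2)[symmetric])
    then have "\<epsilon> * ((?l\<^sup>2 / 2 + ?l ^ 3) * ?V) \<le> \<epsilon> * r"
      using lV(2) \<epsilon>_pos by (intro mult_left_mono) auto
    then have "ereal (\<epsilon> * ((?l\<^sup>2 / 2 + ?l ^ 3) * ?V) - (\<integral>x. \<epsilon> * ln (Z x) \<partial>Phat)) \<le> ereal \<rho>"
      by (simp add: radius)
    with le_P have "sinkhorn \<Omega> c \<epsilon> Phat P \<le> ereal \<rho>"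
      by (rule order_trans)
    \<comment> \<open>Shrinking the multiplier costs \<open>l\<^sup>2 * ?V = 2 * r\<close> in the
      gain, the same error as in the upper bound.\<close>
    moreover have "?l * ?V = s * t - 2 * r"
      using lV(1,2) by (simp add: algebra_simps power2_eq_square)
    ultimately show thesis
      using P that by simp
  qed

  \<comment> \<open>The reals are only conditionally complete: the witness \<open>P\<close> makes
    the set nonempty, and \<open>upper\<close> bounds it.\<close>
  have "(SUP P \<in> ?S. measure P E) \<le> (\<integral>x. p x \<partial>Phat) + s * t + 2 * r"
    by (rule cSUP_least) (use P upper in blast)+
  moreover have "measure P E \<le> (SUP P \<in> ?S. measure P E)"
    by (rule cSUP_upper[OF P(1)], rule bdd_aboveI2[of _ _ "(\<integral>x. p x \<partial>Phat) + s * t + 2 * r"], rule upper)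
  ultimately show ?thesis
    using P(2) by (simp add: s_def t_def)
qed

end

section \<open>The degenerate case of null volume, and uniformity in \<open>\<epsilon>\<close> and
  \<open>Phat\<close>\<close>

lemma AE_lebesgue_of_False_iff:
  assumes "\<Omega> \<in> sets borel"
  shows "(AE z in lebesgue_of \<Omega>. False) \<longleftrightarrow> emeasure lborel \<Omega> = 0"
proof -
  have "(AE z in lebesgue_of \<Omega>. False) \<longleftrightarrow> emeasure (lebesgue_of \<Omega>) \<Omega> = 0"
    using assms by (intro AE_iff_measurable) (auto simp: space_restrict_space sets_restrict_space_iff)
  then show ?thesis
    using assms by (simp add: emeasure_restrict_space)
qed

lemma partition_fn_pos:
  assumes "integrable (lebesgue_of \<Omega>) (\<lambda>z. exp (- c x z / \<epsilon>))" and "emeasure lborel \<Omega> \<noteq> 0"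
    and "\<Omega> \<in> sets borel"
  shows "0 < partition_fn \<Omega> c \<epsilon> x"
proof -
  have "partition_fn \<Omega> c \<epsilon> x \<noteq> 0"
  proof
    assume "partition_fn \<Omega> c \<epsilon> x = 0"
    then have "AE z in lebesgue_of \<Omega>. exp (- c x z / \<epsilon>) = 0"
      using assms(1) unfolding partition_fn_def by (subst (asm) integral_nonneg_eq_0_iff_AE) auto
    then show False
      using assms(2,3) by (simp add: AE_lebesgue_of_False_iff)
  qed
  then show ?thesis
    by (simp add: partition_fn_def order_neq_le_trans)
qed

text \<open>On a null \<open>\<Omega>\<close> every \<open>gibbs\<close> is the zero measure. A
  positive lower bound on the variance therefore forces positive volume, and with it a positive
  partition function.\<close>

lemma sigma_sq_null:
  assumes "emeasure lborel \<Omega> = 0" "\<Omega> \<in> sets borel"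
  shows "sigma_sq \<Omega> c E Phat \<epsilon> = 0"
proof -
  have "partition_fn \<Omega> c \<epsilon> x = 0" for x
  proof -
    have "AE z in lebesgue_of \<Omega>. False"
      using assms by (simp add: AE_lebesgue_of_False_iff)
    then show ?thesis
      unfolding partition_fn_def by (intro integral_eq_zero_AE) (auto elim: eventually_mono)
  qed
  then have "gibbs \<Omega> c \<epsilon> x = density (lebesgue_of \<Omega>) (\<lambda>_. 0)" for x
    by (simp add: gibbs_def)
  then have null: "AE z in gibbs \<Omega> c \<epsilon> x. False" for x
    by (simp only: AE_density[OF borel_measurable_const]) simp
  have "prob_space.variance (gibbs \<Omega> c \<epsilon> x) (indicator E) = (0::real)" for x
    by (rule integral_eq_zero_AE, rule eventually_mono[OF null]) simp
  then show ?thesis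
    by (simp add: sigma_sq_def)
qed

lemma sigma_sq_nonneg: "0 \<le> sigma_sq \<Omega> c E Phat \<epsilon>"
  by (simp add: sigma_sq_def)

theorem proposition4:
  fixes \<Omega> E :: "(real ^ 'd) set" and c :: "real ^ 'd \<Rightarrow> real ^ 'd \<Rightarrow> real" and b0 \<eta> :: real
  assumes "\<Omega> \<in> sets borel" and "E \<in> sets borel" and "E \<subseteq> \<Omega>"
    and "(\<lambda>(x, z). c x z) \<in> borel_measurable (borel_of \<Omega> \<Otimes>\<^sub>M borel_of \<Omega>)"
    and "b0 > 0" and "\<eta> > 0"
  shows "\<exists>\<delta>0 > 0. \<forall>\<epsilon> > 0. \<forall>Phat. \<forall>\<rho>.
    prob_measure_on \<Omega> Phat \<longrightarrow>
    (\<forall>\<epsilon>' > 0. AE x in Phat. integrable (lebesgue_of \<Omega>) (\<lambda>z. exp (- c x z / \<epsilon>'))) \<longrightarrow>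
    integrable Phat (\<lambda>x. \<epsilon> * ln (partition_fn \<Omega> c \<epsilon> x)) \<longrightarrow>
    (INF \<epsilon>' \<in> {0<..}. sigma_sq \<Omega> c E Phat \<epsilon>') \<ge> b0 \<longrightarrow>
    0 < modified_radius \<Omega> c Phat \<epsilon> \<rho> / \<epsilon> \<longrightarrow>
    modified_radius \<Omega> c Phat \<epsilon> \<rho> / \<epsilon> < \<delta>0 \<longrightarrow>
    \<bar>(SUP P \<in> {P. prob_measure_on \<Omega> P \<and> sinkhorn \<Omega> c \<epsilon> Phat P \<le> ereal \<rho>}. measure P E)
       - ((\<integral>x. measure (gibbs \<Omega> c \<epsilon> x) E \<partial>Phat)
          + sqrt (2 * modified_radius \<Omega> c Phat \<epsilon> \<rho> / \<epsilon>) * sqrt (sigma_sq \<Omega> c E Phat \<epsilon>))\<bar>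
     \<le> \<eta> * sqrt (modified_radius \<Omega> c Phat \<epsilon> \<rho> / \<epsilon>)"
proof (intro exI[of _ "min (b0 / 2) (\<eta>\<^sup>2 / 4)"] conjI allI impI)
  \<comment> \<open>The bound \<open>b0 / 2\<close> ensures
    \<open>2 * r \<le> sigma_sq \<Omega> c E Phat \<epsilon>\<close>; the bound
    \<open>\<eta>\<^sup>2 / 4\<close> turns the error \<open>2 * r\<close> into at most
    \<open>\<eta> * sqrt r\<close>.\<close>
  show "0 < min (b0 / 2) (\<eta>\<^sup>2 / 4)"
    using assms by simp
next
  fix \<epsilon> :: real and Phat :: "(real ^ 'd) measure" and \<rho> :: real
  assume \<epsilon>: "0 < \<epsilon>" and Phat: "prob_measure_on \<Omega> Phat"
    and int: "\<forall>\<epsilon>' > 0. AE x in Phat. integrable (lebesgue_of \<Omega>) (\<lambda>z. exp (- c x z / \<epsilon>'))"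
    and ln_Z: "integrable Phat (\<lambda>x. \<epsilon> * ln (partition_fn \<Omega> c \<epsilon> x))"
    and b0: "b0 \<le> (INF \<epsilon>' \<in> {0<..}. sigma_sq \<Omega> c E Phat \<epsilon>')"
    and pos: "0 < modified_radius \<Omega> c Phat \<epsilon> \<rho> / \<epsilon>"
    and small: "modified_radius \<Omega> c Phat \<epsilon> \<rho> / \<epsilon> < min (b0 / 2) (\<eta>\<^sup>2 / 4)"
  define r where "r = modified_radius \<Omega> c Phat \<epsilon> \<rho> / \<epsilon>"
  \<comment> \<open>Nonnegativity bounds the family below, so the real infimum does lie below its
    value at \<open>\<epsilon>\<close>.\<close>
  have "(INF \<epsilon>' \<in> {0<..}. sigma_sq \<Omega> c E Phat \<epsilon>') \<le> sigma_sq \<Omega> c E Phat \<epsilon>"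
    using \<epsilon> by (intro cINF_lower bdd_belowI2[of _ 0] sigma_sq_nonneg) auto
  with b0 have V: "b0 \<le> sigma_sq \<Omega> c E Phat \<epsilon>"
    by simp
  then have "emeasure lborel \<Omega> \<noteq> 0"
    using \<open>b0 > 0\<close> sigma_sq_null[OF _ \<open>\<Omega> \<in> sets borel\<close>] by fastforce
  then have "AE x in Phat. 0 < partition_fn \<Omega> c \<epsilon> x"
    using int \<epsilon> partition_fn_pos[OF _ _ \<open>\<Omega> \<in> sets borel\<close>] by (auto elim!: eventually_mono)
  then interpret gibbs_coupling \<Omega> E c \<epsilon> Phat
    using assms \<epsilon> Phat ln_Z by unfold_locales auto
  have "2 * r \<le> sigma_sq \<Omega> c E Phat \<epsilon>"
    using small V unfolding r_def[symmetric] by simp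
  then have "\<bar>(SUP P \<in> {P. prob_measure_on \<Omega> P \<and> sinkhorn \<Omega> c \<epsilon> Phat P \<le> ereal \<rho>}. measure P E)
      - ((\<integral>x. p x \<partial>Phat) + sqrt (2 * r) * sqrt (sigma_sq \<Omega> c E Phat \<epsilon>))\<bar> \<le> 2 * r"
    unfolding r_def by (rule worst_case_expansion[OF pos])
  also have "2 * r \<le> \<eta> * sqrt r"
  proof -
    have "sqrt r \<le> sqrt ((\<eta> / 2)\<^sup>2)"
      using small by (intro real_sqrt_le_mono) (simp add: r_def power_divide)
    then have "sqrt r \<le> \<eta> / 2"
      using \<open>\<eta> > 0\<close> by simp
    then have "2 * sqrt r * sqrt r \<le> \<eta> * sqrt r"
      using pos by (intro mult_right_mono) (auto simp: r_def)
    moreover have "2 * sqrt r * sqrt r = 2 * r"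
      using pos unfolding r_def[symmetric] by simp
    ultimately show ?thesis
      by simp
  qed
  finally show "\<bar>(SUP P \<in> {P. prob_measure_on \<Omega> P \<and> sinkhorn \<Omega> c \<epsilon> Phat P \<le> ereal \<rho>}. measure P E)
       - ((\<integral>x. measure (gibbs \<Omega> c \<epsilon> x) E \<partial>Phat)
          + sqrt (2 * modified_radius \<Omega> c Phat \<epsilon> \<rho> / \<epsilon>) * sqrt (sigma_sq \<Omega> c E Phat \<epsilon>))\<bar>
     \<le> \<eta> * sqrt (modified_radius \<Omega> c Phat \<epsilon> \<rho> / \<epsilon>)"
    by (simp add: r_def p_def)
qed

end
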